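(* Let $(X_n)_{n\in\mathbb Z}$ be a stationary augmented GARCH(1,1) process (as defined in the context) with $\mathbb E(X_0^4)<\infty$ and $\sum_{k=1}^\infty\operatorname{Cov}(X_1^2,X_k^2)<\infty$, and let $T_n=\frac1{\sqrt n}\sum_{k=1}^n[X_k^2-\mathbb E(X_0^2)]$. Then for every $t\in\mathbb R$, $$\lim_{n\to\infty}\Big|\mathbb P(T_n\le t)-\frac1{\log n}\sum_{k=1}^n\frac1k\mathbb 1_{\{T_k\le t\}}\Big|=0\quad\text{almost surely.}$$
   Context: A stationary augmented GARCH(1,1) process: there is an i.i.d. real sequence $(\xi_n)_{n\in\mathbb Z}$ with $\mathbb E\xi_0=0$, $\mathbb E\xi_0^2=1$, a positive stationary process $(\sigma_n)_{n\in\mathbb Z}$ with $\sigma_n$ measurable with respect to $\sigma(\xi_k:k\le n-1)$, a coordinatewise nondecreasing measurable function $\varphi:\mathbb R^2\to\mathbb R$ and a strictly increasing measurable function $\Lambda:\mathbb R_+\to\mathbb R$ such that $X_n=\sigma_n\xi_n$ and $\Lambda(\sigma_n^2)=\varphi(\Lambda(\sigma_{n-1}^2),\xi_{n-1}^2)$ for all $n$. *)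

theory Defs
  imports "HOL-Probability.Probability"
begin

definition (in prob_space) covar :: "('a \<Rightarrow> real) \<Rightarrow> ('a \<Rightarrow> real) \<Rightarrow> real" where
  "covar X Y = expectation (\<lambda>\<omega>. (X \<omega> - expectation X) * (Y \<omega> - expectation Y))"

definition (in prob_space) stationary_process :: "(int \<Rightarrow> 'a \<Rightarrow> real) \<Rightarrow> bool" where
  "stationary_process Y \<longleftrightarrow>
     (\<forall>k. random_variable borel (Y k)) \<and>
     (\<forall>h. distr M (PiM UNIV (\<lambda>_. borel)) (\<lambda>\<omega> k. Y (k + h) \<omega>)
          = distr M (PiM UNIV (\<lambda>_. borel)) (\<lambda>\<omega> k. Y k \<omega>))"

definition past_sigma :: "'a measure \<Rightarrow> (int \<Rightarrow> 'a \<Rightarrow> real) \<Rightarrow> int \<Rightarrow> 'a measure" where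
  "past_sigma M \<xi> m =
     sigma (space M) {\<xi> k -` B \<inter> space M | k B. k \<le> m \<and> B \<in> sets (borel :: real measure)}"

definition (in prob_space) aug_garch ::
  "(int \<Rightarrow> 'a \<Rightarrow> real) \<Rightarrow> (int \<Rightarrow> 'a \<Rightarrow> real) \<Rightarrow> (int \<Rightarrow> 'a \<Rightarrow> real)
    \<Rightarrow> (real \<times> real \<Rightarrow> real) \<Rightarrow> (real \<Rightarrow> real) \<Rightarrow> bool" where
  "aug_garch X \<xi> \<sigma> \<phi> \<Lambda> \<longleftrightarrow>
     indep_vars (\<lambda>_. borel) \<xi> UNIV \<and>
     (\<forall>k. distr M borel (\<xi> k) = distr M borel (\<xi> 0)) \<and>
     integrable M (\<xi> 0) \<and> expectation (\<xi> 0) = 0 \<and>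
     integrable M (\<lambda>\<omega>. (\<xi> 0 \<omega>)\<^sup>2) \<and> expectation (\<lambda>\<omega>. (\<xi> 0 \<omega>)\<^sup>2) = 1 \<and>
     (\<forall>n. \<forall>\<omega>\<in>space M. \<sigma> n \<omega> > 0) \<and>
     stationary_process \<sigma> \<and>
     (\<forall>n. \<sigma> n \<in> borel_measurable (past_sigma M \<xi> (n - 1))) \<and>
     \<phi> \<in> borel_measurable borel \<and>
     (\<forall>a a' b b'. a \<le> a' \<longrightarrow> b \<le> b' \<longrightarrow> \<phi> (a, b) \<le> \<phi> (a', b')) \<and>
     \<Lambda> \<in> borel_measurable (restrict_space borel {0..}) \<and>
     strict_mono_on {0..} \<Lambda> \<and>
     (\<forall>n. \<forall>\<omega>\<in>space M. X n \<omega> = \<sigma> n \<omega> * \<xi> n \<omega>) \<and>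
     (\<forall>n. \<forall>\<omega>\<in>space M.
        \<Lambda> ((\<sigma> n \<omega>)\<^sup>2) = \<phi> (\<Lambda> ((\<sigma> (n - 1) \<omega>)\<^sup>2), (\<xi> (n - 1) \<omega>)\<^sup>2))"

end

theory Submission
  imports Defs
begin

text \<open>
  The squares \<open>X\<^sub>k\<^sup>2\<close> are nondecreasing functions of the independent variables
  \<open>\<sigma>\<^sub>1\<^sup>2, \<xi>\<^sub>1\<^sup>2, \<xi>\<^sub>2\<^sup>2, \<dots>\<close>, hence any two sums of them are positively quadrant dependent. For such a pair
  \<open>U, V\<close> and Lipschitz \<open>f, g\<close>, monotonicity of \<open>a x \<plusminus> f x\<close> and \<open>b x \<plusminus> g x\<close> bounds the covariance of \<open>f U\<close> and \<open>g V\<close> by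
  \<open>a b Cov(U, V)\<close>. Applied to \<open>cos\<close> and \<open>sin\<close>, this compares the characteristic function of a sum of blocks with
  that of independent blocks and gives Newman's central limit theorem. Applied to \<open>T\<^sub>j, T\<^sub>k\<close> it gives
  \<open>Cov(f(T\<^sub>j), f(T\<^sub>k)) = O(sqrt(j/k))\<close>, so the logarithmic averages have variance \<open>O(1/log n)\<close>; they converge almost surely
  along \<open>n = 2^(i^2)\<close> by summability and then along all \<open>n\<close>. Indicators of half-lines are squeezed
  between Lipschitz functions, and the degenerate case of zero limiting variance is trivial.
\<close>

section \<open>Logarithmic averages\<close>

text \<open>The delicate point in the monotonicity claim is \<open>\<Lambda>\<close>: if it is
  bounded above, its inverse blows up at the end of the range and has no monotone real extension to
  the line. The squares are therefore rebuilt with an inverse capped at K, for which every map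
  involved is monotone, and the cap is removed at the end. Dependence is handled by a Markov
  recursion: two weighted partial sums together with \<open>\<Lambda>\<close> of the current squared
  volatility form a state, and each step adds one innovation independent of that state. The same
  recursion gives shift invariance of the squares jointly, since stationarity of
  \<open>\<sigma>\<close> alone does not describe the joint law of \<open>\<sigma>\<close> and
  \<open>\<xi>\<close>. The central limit theorem uses two scales: first n grows with the block
  length m fixed, and the dependence left between blocks is measured by the gap between the limiting
  variance and v(m)/m; then m grows. The exponent i^2 is a compromise: log n becomes a multiple of
  i^2, so a variance of order 1/log n is summable in i, while (i+1)^2 / i^2 tends to 1, so the gaps
  between the chosen n do no harm.\<close>

lemma weighted_mean_tendsto:
  fixes a w :: "nat \<Rightarrow> real"
  assumes w: "\<And>k. w k \<ge> 0" and W: "filterlim (\<lambda>n. \<Sum>k<n. w k) at_top sequentially"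
    and a: "a \<longlonglongrightarrow> l"
  shows "(\<lambda>n. (\<Sum>k<n. w k * a k) / (\<Sum>k<n. w k)) \<longlonglongrightarrow> l"
proof (rule LIMSEQ_I)
  fix e :: real assume e: "e > 0"
  then obtain N where N: "\<And>k. k \<ge> N \<Longrightarrow> \<bar>a k - l\<bar> < e / 2"
    using LIMSEQ_D[OF a, of "e/2"] by auto
  define C where "C = (\<Sum>k<N. w k * \<bar>a k - l\<bar>)"
  have C0: "C \<ge> 0" unfolding C_def by (intro sum_nonneg mult_nonneg_nonneg w) auto
  \<comment> \<open>This threshold gives C < e / 2 * W for the total weight W, so the head uses less
    than half of the tolerance, and it forces W > 0 even when C = 0.\<close>
  obtain N1 where N1: "\<And>n. n \<ge> N1 \<Longrightarrow> (\<Sum>k<n. w k) \<ge> 2 * C / e + 1"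
    using W unfolding filterlim_at_top eventually_sequentially by meson
  show "\<exists>no. \<forall>n\<ge>no. norm ((\<Sum>k<n. w k * a k) / (\<Sum>k<n. w k) - l) < e"
  proof (intro exI allI impI)
    fix n assume n: "n \<ge> max N N1"
    let ?W = "\<Sum>k<n. w k"
    have W1: "?W \<ge> 2 * C / e + 1" using N1 n by auto
    have "2 * C / e \<ge> 0" using C0 e by simp
    hence Wpos: "?W > 0" using W1 by linarith
    have "(\<Sum>k<n. w k * a k) / ?W - l = (\<Sum>k<n. w k * (a k - l)) / ?W"
      using Wpos by (simp add: field_simps sum_subtractf sum_distrib_left sum_distrib_right)
    moreover have "\<bar>\<Sum>k<n. w k * (a k - l)\<bar> \<le> (\<Sum>k<n. w k * \<bar>a k - l\<bar>)"
      by (rule order_trans[OF sum_abs]) (simp add: abs_mult w)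
    moreover have "\<dots> \<le> C + e / 2 * ?W"
    proof -
      have "(\<Sum>k<n. w k * \<bar>a k - l\<bar>) = C + (\<Sum>k=N..<n. w k * \<bar>a k - l\<bar>)"
        unfolding C_def lessThan_atLeast0 using n by (subst sum.atLeastLessThan_concat) auto
      also have "(\<Sum>k=N..<n. w k * \<bar>a k - l\<bar>) \<le> (\<Sum>k=N..<n. w k * (e / 2))"
        by (intro sum_mono mult_left_mono w less_imp_le[OF N]) auto
      also have "\<dots> \<le> (\<Sum>k<n. w k * (e / 2))"
        by (rule sum_mono2) (use w e in auto)
      finally show ?thesis by (simp only: sum_distrib_right[symmetric] mult.commute)
    qed
    moreover have "C + e / 2 * ?W < e * ?W"
      using W1 e C0 by (simp add: field_simps)
    ultimately show "norm ((\<Sum>k<n. w k * a k) / ?W - l) < e"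
      using Wpos by (simp add: field_simps)
  qed
qed

lemma cesaro_tendsto:
  fixes a :: "nat \<Rightarrow> real"
  assumes "a \<longlonglongrightarrow> l"
  shows "(\<lambda>n. (\<Sum>k<n. a k) / real n) \<longlonglongrightarrow> l"
proof -
  have "filterlim (\<lambda>n. \<Sum>k<n. (1::real)) at_top sequentially"
    by (simp add: filterlim_real_sequentially)
  from weighted_mean_tendsto[OF _ this assms] show ?thesis by simp
qed

lemma harm_eq_sum_lessThan: "harm n = (\<Sum>k<n. 1 / (real k + 1))"
  by (induction n) (auto simp: harm_Suc harm_expand field_simps)

lemma harm_over_ln_tendsto: "(\<lambda>n. harm n / ln (real n)) \<longlonglongrightarrow> 1"
proof -
  have L: "filterlim (\<lambda>n. ln (real n)) at_top sequentially"
    by (rule filterlim_compose[OF ln_at_top filterlim_real_sequentially])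
  have "(\<lambda>n. (harm n - ln (real n)) / ln (real n)) \<longlonglongrightarrow> 0"
    by (rule tendsto_divide_0[OF euler_mascheroni_LIMSEQ])
      (rule filterlim_at_top_imp_at_infinity[OF L])
  from tendsto_add[OF this tendsto_const[of 1]]
  have "(\<lambda>n. (harm n - ln (real n)) / ln (real n) + 1) \<longlonglongrightarrow> 1" by simp
  moreover have "\<forall>\<^sub>F n in sequentially. (harm n - ln (real n)) / ln (real n) + 1 = harm n / ln (real n)"
    using eventually_gt_at_top[of 1] by eventually_elim (simp add: field_simps)
  ultimately show ?thesis by (rule Lim_transform_eventually)
qed

text \<open>The total weight is \<open>harm n\<close>, which is only asymptotically equal to the
  normalisation \<open>ln n\<close>. At n = 1 the prefactor is 1 / 0 = 0.\<close>

definition log_mean :: "(nat \<Rightarrow> real) \<Rightarrow> nat \<Rightarrow> real" where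
  "log_mean a n = (1 / ln (real n)) * (\<Sum>k=1..n. (1 / real k) * a k)"

lemma log_mean_tendsto:
  assumes a: "a \<longlonglongrightarrow> l"
  shows "log_mean a \<longlonglongrightarrow> l"
proof -
  have "filterlim (\<lambda>n. \<Sum>k<n. 1 / (real k + 1)) at_top sequentially"
    using harm_at_top by (simp add: harm_eq_sum_lessThan[symmetric] )
  from weighted_mean_tendsto[OF _ this LIMSEQ_Suc[OF a]]
  have "(\<lambda>n. (\<Sum>k<n. 1 / (real k + 1) * a (Suc k)) / harm n) \<longlonglongrightarrow> l"
    by (simp add: harm_eq_sum_lessThan)
  from tendsto_mult[OF this harm_over_ln_tendsto]
  have "(\<lambda>n. (\<Sum>k<n. 1 / (real k + 1) * a (Suc k)) / harm n * (harm n / ln (real n))) \<longlonglongrightarrow> l"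
    by simp
  moreover have "\<forall>\<^sub>F n in sequentially.
    (\<Sum>k<n. 1 / (real k + 1) * a (Suc k)) / harm n * (harm n / ln (real n)) = log_mean a n"
    using eventually_gt_at_top[of 1]
  proof eventually_elim
    case (elim n)
    have "(\<Sum>k=1..n. (1 / real k) * a k) = (\<Sum>k<n. 1 / (real k + 1) * a (Suc k))"
      by (rule sum.reindex_bij_witness[of _ Suc "\<lambda>k. k - 1"]) (auto simp: add_ac)
    moreover have "harm n > (0::real)" using elim by (simp add: harm_pos)
    ultimately show ?case using elim by (simp add: log_mean_def less_imp_neq[symmetric])
  qed
  ultimately show ?thesis by (rule Lim_transform_eventually)
qed

lemma sum_inverse_le_ln:
  assumes "m \<ge> 1" "m \<le> n"
  shows "(\<Sum>k=m+1..n. 1 / real k) \<le> ln (real n) - ln (real m)"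
  using assms(2)
proof (induction n rule: dec_induct)
  case (step n)
  \<comment> \<open>Applying \<open>ln x \<le> x - 1\<close> at the ratio n / (n + 1), not at its
    reciprocal, bounds the increment of \<open>ln\<close> from below.\<close>
  have "1 / real (Suc n) \<le> ln (real (Suc n)) - ln (real n)"
  proof -
    have "ln (real n / real (Suc n)) \<le> real n / real (Suc n) - 1"
      using step assms by (intro ln_le_minus_one) auto
    moreover have "ln (real n / real (Suc n)) = ln (real n) - ln (real (Suc n))"
      using step assms by (subst ln_div) auto
    moreover have "real n / real (Suc n) - 1 = - (1 / real (Suc n))" by (simp add: field_simps)
    ultimately show ?thesis by linarith
  qed
  with step show ?case by (simp add: sum.nat_ivl_Suc')
qed auto

text \<open>For n between m = 2^(i^2) and 2^((i+1)^2) the terms after m weigh at most ln n - ln m,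
  which is of order i, against ln n of order i^2. Bounded terms thus change the mean by
  O(1/i).\<close>

lemma log_mean_tendsto_0_subsequence:
  assumes B: "\<And>k. \<bar>a k\<bar> \<le> B"
    and sub: "(\<lambda>i. log_mean a (2 ^ (i\<^sup>2))) \<longlonglongrightarrow> 0"
  shows "log_mean a \<longlonglongrightarrow> 0"
proof -
  define L where "L n = log 2 (real n)" for n :: nat
  \<comment> \<open>For n \<ge> 1 this is the largest i with 2^(i^2) \<le> n.\<close>
  define g where "g n = nat \<lfloor>sqrt (L n)\<rfloor>" for n :: nat
  define D where "D n = (\<Sum>k=1..n. (1 / real k) * a k)" for n :: nat
  have B0: "B \<ge> 0" using B[of 0] by linarith
  have L_top: "filterlim L at_top sequentially"
    unfolding L_def log_def
    by (rule filterlim_at_top_mult_tendsto_pos[of "\<lambda>n. 1 / ln 2" "1 / ln 2", 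
          THEN filterlim_cong[THEN iffD1, rotated -1]])
      (auto intro!: filterlim_compose[OF ln_at_top filterlim_real_sequentially])
  have sL_top: "filterlim (\<lambda>n. sqrt (L n)) at_top sequentially"
    by (rule filterlim_compose[OF sqrt_at_top L_top])
  have g_top: "filterlim g at_top sequentially"
    unfolding g_def
    by (rule filterlim_compose[OF filterlim_nat_sequentially])
      (rule filterlim_compose[OF filterlim_floor_sequentially sL_top])
  have "(\<lambda>n. log_mean a (2 ^ ((g n)\<^sup>2))) \<longlonglongrightarrow> 0"
    by (rule filterlim_compose[OF sub g_top])
  hence 1: "(\<lambda>n. \<bar>log_mean a (2 ^ ((g n)\<^sup>2))\<bar>) \<longlonglongrightarrow> 0" by (simp add: tendsto_rabs_zero_iff)
  have "((\<lambda>x. (2 * sqrt x + 1) / x) \<longlongrightarrow> 0) at_top" by real_asymp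
  from filterlim_compose[OF this L_top]
  have 2: "(\<lambda>n. B * ((2 * sqrt (L n) + 1) / L n)) \<longlonglongrightarrow> 0"
    using tendsto_mult_right_zero by blast
  from tendsto_add[OF 1 2]
  have 3: "(\<lambda>n. \<bar>log_mean a (2 ^ ((g n)\<^sup>2))\<bar> + B * ((2 * sqrt (L n) + 1) / L n)) \<longlonglongrightarrow> 0" by simp
  show ?thesis
  proof (rule Lim_null_comparison[OF _ 3])
    show "\<forall>\<^sub>F n in sequentially. norm (log_mean a n)
            \<le> \<bar>log_mean a (2 ^ ((g n)\<^sup>2))\<bar> + B * ((2 * sqrt (L n) + 1) / L n)"
      using eventually_ge_at_top[of 2]
    proof eventually_elim
      case (elim n)
      define m :: nat where "m = 2 ^ ((g n)\<^sup>2)"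
      have L1: "L n \<ge> 1" using elim unfolding L_def by (simp add: le_log_iff)
      have s1: "sqrt (L n) \<ge> 1" using L1 by simp
      have gs: "real (g n) \<le> sqrt (L n)" "sqrt (L n) < real (g n) + 1" 
        unfolding g_def using s1 by linarith+
      have "1 \<le> g n" using s1 unfolding g_def by linarith
      hence m2: "m \<ge> 2" unfolding m_def using self_le_power[of "2::nat" "(g n)\<^sup>2"] by simp
      have lnm: "ln (real m) = (real (g n))\<^sup>2 * ln 2"
        unfolding m_def by (simp add: ln_realpow)
      have lnn: "ln (real n) = L n * ln 2" by (simp add: L_def log_def)
      have sq: "(sqrt (L n))\<^sup>2 = L n" using L1 by simp
      have g2: "(real (g n))\<^sup>2 \<le> L n" 
        using power_mono[OF gs(1), of 2] sq by simp
      have g3: "L n - (real (g n))\<^sup>2 \<le> 2 * sqrt (L n) + 1"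
      proof -
        have "(sqrt (L n))\<^sup>2 \<le> (real (g n) + 1)\<^sup>2" using gs s1 by (intro power_mono) auto
        thus ?thesis using sq gs by (simp add: power2_eq_square algebra_simps)
      qed
      have lnmn: "ln (real m) \<le> ln (real n)" unfolding lnm lnn using g2 by simp
      hence mn: "m \<le> n" using elim m2 by simp
      have lnm0: "ln (real m) > 0" using m2 by simp
      have lnn0: "ln (real n) > 0" using elim by simp
      have "D n = D m + (\<Sum>k=m+1..n. (1 / real k) * a k)"
        unfolding D_def using sum.ub_add_nat[of 1 m "\<lambda>k. (1 / real k) * a k" "n - m"] mn by simp
      moreover have "\<bar>\<Sum>k=m+1..n. (1 / real k) * a k\<bar> \<le> (\<Sum>k=m+1..n. (1 / real k) * B)"
        by (rule order_trans[OF sum_abs]) (auto intro!: sum_mono divide_right_mono B simp: abs_mult)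
      moreover have "(\<Sum>k=m+1..n. (1 / real k) * B) \<le> (ln (real n) - ln (real m)) * B"
        unfolding sum_distrib_right[symmetric]
        by (intro mult_right_mono sum_inverse_le_ln B0 mn) (use m2 in auto)
      ultimately have Dn: "\<bar>D n\<bar> \<le> \<bar>D m\<bar> + (ln (real n) - ln (real m)) * B" by linarith
      have "norm (log_mean a n) = \<bar>D n\<bar> / ln (real n)"
        using lnn0 by (simp add: log_mean_def D_def abs_mult)
      also have "\<dots> \<le> \<bar>D m\<bar> / ln (real n) + (ln (real n) - ln (real m)) * B / ln (real n)"
        using Dn lnn0 by (simp add: add_divide_distrib[symmetric] divide_right_mono)
      also have "\<bar>D m\<bar> / ln (real n) \<le> \<bar>D m\<bar> / ln (real m)"
        using lnm0 lnmn by (intro divide_left_mono) auto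
      also have "\<bar>D m\<bar> / ln (real m) = \<bar>log_mean a m\<bar>"
        using lnm0 by (simp add: log_mean_def D_def abs_mult)
      also have "(ln (real n) - ln (real m)) * B / ln (real n) = B * ((L n - (real (g n))\<^sup>2) / L n)"
        unfolding lnn lnm using L1 by (simp add: field_simps)
      also have "\<dots> \<le> B * ((2 * sqrt (L n) + 1) / L n)"
        using g3 L1 B0 by (intro mult_left_mono divide_right_mono) auto
      finally show ?case by (simp add: m_def)
    qed
  qed
qed

section \<open>Positive quadrant dependence\<close>

lemma integrable_mult_of_squares:
  fixes f g :: "'a \<Rightarrow> real"
  assumes [measurable]: "f \<in> borel_measurable M" "g \<in> borel_measurable M"
    and "integrable M (\<lambda>x. (f x)\<^sup>2)" "integrable M (\<lambda>x. (g x)\<^sup>2)"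
  shows "integrable M (\<lambda>x. f x * g x)"
proof (rule Bochner_Integration.integrable_bound)
  show "integrable M (\<lambda>x. (f x)\<^sup>2 + (g x)\<^sup>2)" using assms by auto
  show "AE x in M. norm (f x * g x) \<le> norm ((f x)\<^sup>2 + (g x)\<^sup>2)"
  proof (intro AE_I2)
    fix x
    have "2 * (\<bar>f x\<bar> * \<bar>g x\<bar>) \<le> (f x)\<^sup>2 + (g x)\<^sup>2"
      using sum_squares_bound[of "\<bar>f x\<bar>" "\<bar>g x\<bar>"] by (simp add: mult.assoc)
    moreover have "0 \<le> \<bar>f x\<bar> * \<bar>g x\<bar>" by simp
    ultimately have "\<bar>f x\<bar> * \<bar>g x\<bar> \<le> (f x)\<^sup>2 + (g x)\<^sup>2" by linarith
    thus "norm (f x * g x) \<le> norm ((f x)\<^sup>2 + (g x)\<^sup>2)" by (simp add: abs_mult)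
  qed
qed simp

lemma integrable_square_add:
  fixes f g :: "'a \<Rightarrow> real"
  assumes [measurable]: "f \<in> borel_measurable M" "g \<in> borel_measurable M"
    and "integrable M (\<lambda>x. (f x)\<^sup>2)" "integrable M (\<lambda>x. (g x)\<^sup>2)"
  shows "integrable M (\<lambda>x. (f x + g x)\<^sup>2)"
  using assms integrable_mult_of_squares[OF assms] by (simp add: power2_sum mult.assoc)

lemma integrable_square_cmult:
  fixes f :: "'a \<Rightarrow> real"
  assumes "integrable M (\<lambda>x. (f x)\<^sup>2)"
  shows "integrable M (\<lambda>x. (c * f x)\<^sup>2)"
  using assms by (simp add: power_mult_distrib)

lemma integrable_square_sum:
  fixes f :: "'i \<Rightarrow> 'a \<Rightarrow> real"
  assumes "\<And>i. i \<in> I \<Longrightarrow> f i \<in> borel_measurable M" "\<And>i. i \<in> I \<Longrightarrow> integrable M (\<lambda>x. (f i x)\<^sup>2)"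
  shows "integrable M (\<lambda>x. (\<Sum>i\<in>I. f i x)\<^sup>2)"
  using assms
proof (induction I rule: infinite_finite_induct)
  case (insert i I)
  then show ?case by (auto intro!: integrable_square_add)
qed auto

lemma lipschitz_borel_measurable:
  fixes f :: "real \<Rightarrow> real"
  assumes "\<And>x y. \<bar>f x - f y\<bar> \<le> a * \<bar>x - y\<bar>"
  shows "f \<in> borel_measurable borel"
proof (rule borel_measurable_continuous_onI)
  have "(max a 0)-lipschitz_on UNIV f"
    using assms order_trans[OF _ mult_right_mono[of a "max a 0"]]
    by (intro lipschitz_onI) (auto simp: dist_real_def)
  thus "continuous_on UNIV f" by (rule lipschitz_on_continuous_on)
qed

lemma (in prob_space) integrable_square_lipschitz:
  fixes f :: "real \<Rightarrow> real"
  assumes [measurable]: "random_variable borel U" and "integrable M (\<lambda>x. (U x)\<^sup>2)"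
    and f: "\<And>x y. \<bar>f x - f y\<bar> \<le> a * \<bar>x - y\<bar>"
  shows "integrable M (\<lambda>x. (f (U x))\<^sup>2)"
proof (rule Bochner_Integration.integrable_bound)
  note lipschitz_borel_measurable[OF f, measurable]
  show "(\<lambda>x. (f (U x))\<^sup>2) \<in> borel_measurable M" by measurable
  show "integrable M (\<lambda>x. 2 * (f 0)\<^sup>2 + 2 * (a\<^sup>2 * (U x)\<^sup>2))" using assms(2) by auto
  show "AE x in M. norm ((f (U x))\<^sup>2) \<le> norm (2 * (f 0)\<^sup>2 + 2 * (a\<^sup>2 * (U x)\<^sup>2))"
  proof (intro AE_I2)
    fix x
    have "\<bar>f (U x)\<bar> \<le> \<bar>f 0\<bar> + \<bar>a\<bar> * \<bar>U x\<bar>"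
      using f[of "U x" 0] mult_right_mono[of a "\<bar>a\<bar>" "\<bar>U x\<bar>"] abs_ge_self[of a] by simp linarith
    hence "(f (U x))\<^sup>2 \<le> (\<bar>f 0\<bar> + \<bar>a\<bar> * \<bar>U x\<bar>)\<^sup>2"
      using power_mono[of "\<bar>f (U x)\<bar>" _ 2] by simp
    also have "\<dots> \<le> 2 * (f 0)\<^sup>2 + 2 * (a\<^sup>2 * (U x)\<^sup>2)"
      using sum_squares_bound[of "\<bar>f 0\<bar>" "\<bar>a\<bar> * \<bar>U x\<bar>"]
      by (simp add: power2_sum power_mult_distrib)
    finally show "norm ((f (U x))\<^sup>2) \<le> norm (2 * (f 0)\<^sup>2 + 2 * (a\<^sup>2 * (U x)\<^sup>2))" by simp
  qed
qed

lemma abs_sin_diff_le: "\<bar>sin x - sin y\<bar> \<le> \<bar>x - y\<bar>" for x y :: real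
proof -
  have "\<bar>sin x - sin y\<bar> = 2 * (\<bar>sin ((x - y) / 2)\<bar> * \<bar>cos ((x + y) / 2)\<bar>)"
    by (simp add: sin_diff_sin abs_mult)
  also have "\<dots> \<le> 2 * (\<bar>(x - y) / 2\<bar> * 1)"
    by (intro mult_left_mono mult_mono abs_sin_x_le_abs_x) auto
  finally show ?thesis by simp
qed

lemma abs_cos_diff_le: "\<bar>cos x - cos y\<bar> \<le> \<bar>x - y\<bar>" for x y :: real
  using abs_sin_diff_le[of "pi / 2 - x" "pi / 2 - y"] by (simp add: cos_sin_eq abs_minus_commute)

section \<open>Covariances and characteristic functions of positively quadrant dependent
  pairs\<close>

context prob_space
begin

text \<open>Indicators of half-lines as test functions give the usual definition.\<close>

definition pqd :: "('a \<Rightarrow> real) \<Rightarrow> ('a \<Rightarrow> real) \<Rightarrow> bool" where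
  "pqd U V \<longleftrightarrow> (\<forall>f g :: real \<Rightarrow> real. mono f \<longrightarrow> mono g \<longrightarrow> bounded (range f) \<longrightarrow> bounded (range g) \<longrightarrow>
     expectation (\<lambda>x. f (U x)) * expectation (\<lambda>x. g (V x)) \<le> expectation (\<lambda>x. f (U x) * g (V x)))"

text \<open>Clamping by \<open>c K\<close> keeps the test functions monotone and makes them bounded.
  The unclamped functions and their product serve as majorants when the clamp is removed; the second
  moments make the product integrable.\<close>

lemma pqd_expectation_mult:
  fixes f g :: "real \<Rightarrow> real"
  assumes UV: "pqd U V" and mono: "mono f" "mono g"
    and [measurable]: "random_variable borel U" "random_variable borel V"
    and f2: "integrable M (\<lambda>x. (f (U x))\<^sup>2)" and g2: "integrable M (\<lambda>x. (g (V x))\<^sup>2)"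
  shows "expectation (\<lambda>x. f (U x)) * expectation (\<lambda>x. g (V x)) \<le> expectation (\<lambda>x. f (U x) * g (V x))"
proof -
  note borel_measurable_mono[OF mono(1), measurable] borel_measurable_mono[OF mono(2), measurable]
  define c :: "nat \<Rightarrow> real \<Rightarrow> real" where "c K y = max (- real K) (min (real K) y)" for K y
  have [measurable]: "c K \<in> borel_measurable borel" for K unfolding c_def by measurable
  have cle: "\<bar>c K y\<bar> \<le> \<bar>y\<bar>" for K y unfolding c_def by auto
  have clim: "(\<lambda>K. c K y) \<longlonglongrightarrow> y" for y
  proof (rule tendsto_eventually)
    obtain N where N: "\<bar>y\<bar> \<le> real N" using real_arch_simple by blast
    show "\<forall>\<^sub>F K in sequentially. c K y = y"
      using eventually_ge_at_top[of N]
    proof eventually_elim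
      case (elim K)
      hence "\<bar>y\<bar> \<le> real K" using N by simp
      thus ?case unfolding c_def by linarith
    qed
  qed
  have cm: "mono (\<lambda>x. c K (h x))" if "mono h" for K and h :: "real \<Rightarrow> real"
  proof (rule monoI)
    fix x y :: real assume "x \<le> y"
    hence "h x \<le> h y" using that by (rule monoD[rotated])
    thus "c K (h x) \<le> c K (h y)" unfolding c_def by auto
  qed
  have cb: "bounded (range (\<lambda>x. c K (h x)))" for K and h :: "real \<Rightarrow> real"
    unfolding bounded_iff by (rule exI[of _ "real K"]) (auto simp: c_def)
  have ineq: "expectation (\<lambda>x. c K (f (U x))) * expectation (\<lambda>x. c K (g (V x)))
      \<le> expectation (\<lambda>x. c K (f (U x)) * c K (g (V x)))" for K
    using UV[unfolded pqd_def] cm[OF mono(1)] cm[OF mono(2)] cb by blast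
  have fi: "integrable M (\<lambda>x. f (U x))" using f2 by (rule square_integrable_imp_integrable[rotated]) measurable
  have gi: "integrable M (\<lambda>x. g (V x))" using g2 by (rule square_integrable_imp_integrable[rotated]) measurable
  have fgi: "integrable M (\<lambda>x. f (U x) * g (V x))" by (intro integrable_mult_of_squares f2 g2) measurable
  have 1: "(\<lambda>K. expectation (\<lambda>x. c K (f (U x)))) \<longlonglongrightarrow> expectation (\<lambda>x. f (U x))"
    by (rule integral_dominated_convergence[where w="\<lambda>x. \<bar>f (U x)\<bar>"]) (use fi clim cle in auto)
  have 2: "(\<lambda>K. expectation (\<lambda>x. c K (g (V x)))) \<longlonglongrightarrow> expectation (\<lambda>x. g (V x))"
    by (rule integral_dominated_convergence[where w="\<lambda>x. \<bar>g (V x)\<bar>"]) (use gi clim cle in auto)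
  have 3: "(\<lambda>K. expectation (\<lambda>x. c K (f (U x)) * c K (g (V x)))) \<longlonglongrightarrow> expectation (\<lambda>x. f (U x) * g (V x))"
    by (rule integral_dominated_convergence[where w="\<lambda>x. \<bar>f (U x) * g (V x)\<bar>"])
      (use integrable_abs[OF fgi] in \<open>auto intro!: tendsto_mult clim mult_mono cle simp: abs_mult\<close>)
  show ?thesis
    by (rule LIMSEQ_le[OF tendsto_mult[OF 1 2] 3]) (use ineq in blast)
qed

text \<open>The monotone functions are paired with opposite signs: \<open>a x + f x\<close> with
  \<open>b x - g x\<close>, and \<open>a x - f x\<close> with \<open>b x + g x\<close>. When the two
  inequalities are added, the mixed covariances of U with g(V) and of f(U) with V cancel, leaving
  twice the claim.\<close>

lemma pqd_lipschitz_cov_upper: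
  fixes f g :: "real \<Rightarrow> real"
  assumes UV: "pqd U V"
    and [measurable]: "random_variable borel U" "random_variable borel V"
    and U2: "integrable M (\<lambda>x. (U x)\<^sup>2)" and V2: "integrable M (\<lambda>x. (V x)\<^sup>2)"
    and f: "\<And>x y. \<bar>f x - f y\<bar> \<le> a * \<bar>x - y\<bar>" and g: "\<And>x y. \<bar>g x - g y\<bar> \<le> b * \<bar>x - y\<bar>"
  shows "expectation (\<lambda>x. f (U x) * g (V x)) - expectation (\<lambda>x. f (U x)) * expectation (\<lambda>x. g (V x))
    \<le> a * b * (expectation (\<lambda>x. U x * V x) - expectation U * expectation V)"
proof -
  note lipschitz_borel_measurable[OF f, measurable] lipschitz_borel_measurable[OF g, measurable]
  note f2 = integrable_square_lipschitz[OF assms(2) U2 f]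
  note g2 = integrable_square_lipschitz[OF assms(3) V2 g]
  have mono_plus: "mono (\<lambda>x. c * x + h x)" "mono (\<lambda>x. c * x - h x)"
    if h: "\<And>x y. \<bar>h x - h y\<bar> \<le> c * \<bar>x - y\<bar>" for c and h :: "real \<Rightarrow> real"
  proof (safe intro!: monoI)
    fix x y :: real assume "x \<le> y"
    thus "c * x + h x \<le> c * y + h y" "c * x - h x \<le> c * y - h y"
      using h[of x y] by (auto simp: abs_if algebra_simps split: if_splits)
  qed
  have [simp]: "integrable M U" "integrable M V" "integrable M (\<lambda>x. f (U x))" "integrable M (\<lambda>x. g (V x))"
    using U2 V2 f2 g2 by (auto intro: square_integrable_imp_integrable)
  have [simp]: "integrable M (\<lambda>x. U x * V x)" "integrable M (\<lambda>x. U x * g (V x))"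
    "integrable M (\<lambda>x. f (U x) * V x)" "integrable M (\<lambda>x. f (U x) * g (V x))"
    using U2 V2 f2 g2 by (auto intro: integrable_mult_of_squares)
  have sq: "integrable M (\<lambda>x. (a * U x + f (U x))\<^sup>2)" "integrable M (\<lambda>x. (b * V x + g (V x))\<^sup>2)"
    "integrable M (\<lambda>x. (a * U x - f (U x))\<^sup>2)" "integrable M (\<lambda>x. (b * V x - g (V x))\<^sup>2)"
    using integrable_square_add[of "\<lambda>x. a * U x" M "\<lambda>x. f (U x)"]
      integrable_square_add[of "\<lambda>x. a * U x" M "\<lambda>x. - f (U x)"]
      integrable_square_add[of "\<lambda>x. b * V x" M "\<lambda>x. g (V x)"]
      integrable_square_add[of "\<lambda>x. b * V x" M "\<lambda>x. - g (V x)"] U2 V2 f2 g2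
    by (auto intro!: integrable_square_cmult)
  have 1: "(a * expectation U + expectation (\<lambda>x. f (U x))) * (b * expectation V - expectation (\<lambda>x. g (V x)))
    \<le> expectation (\<lambda>x. (a * U x + f (U x)) * (b * V x - g (V x)))"
    using pqd_expectation_mult[OF UV mono_plus(1)[OF f] mono_plus(2)[OF g] _ _ sq(1) sq(4)] by simp
  have 2: "(a * expectation U - expectation (\<lambda>x. f (U x))) * (b * expectation V + expectation (\<lambda>x. g (V x)))
    \<le> expectation (\<lambda>x. (a * U x - f (U x)) * (b * V x + g (V x)))"
    using pqd_expectation_mult[OF UV mono_plus(2)[OF f] mono_plus(1)[OF g] _ _ sq(3) sq(2)] by simp
  have e1: "expectation (\<lambda>x. (a * U x + f (U x)) * (b * V x - g (V x))) = 
    a * b * expectation (\<lambda>x. U x * V x) - a * expectation (\<lambda>x. U x * g (V x))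
    + b * expectation (\<lambda>x. f (U x) * V x) - expectation (\<lambda>x. f (U x) * g (V x))"
  proof -
    have "(\<lambda>x. (a * U x + f (U x)) * (b * V x - g (V x))) =
      (\<lambda>x. a * b * (U x * V x) - a * (U x * g (V x)) + b * (f (U x) * V x) - f (U x) * g (V x))"
      by (auto simp: algebra_simps)
    thus ?thesis by simp
  qed
  have e2: "expectation (\<lambda>x. (a * U x - f (U x)) * (b * V x + g (V x))) = 
    a * b * expectation (\<lambda>x. U x * V x) + a * expectation (\<lambda>x. U x * g (V x))
    - b * expectation (\<lambda>x. f (U x) * V x) - expectation (\<lambda>x. f (U x) * g (V x))"
  proof -
    have "(\<lambda>x. (a * U x - f (U x)) * (b * V x + g (V x))) =
      (\<lambda>x. a * b * (U x * V x) + a * (U x * g (V x)) - b * (f (U x) * V x) - f (U x) * g (V x))"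
      by (auto simp: algebra_simps)
    thus ?thesis by simp
  qed
  show ?thesis using 1 2 unfolding e1 e2 by (simp add: algebra_simps)
qed

text \<open>The lower bound is the upper bound for -g, which has the same Lipschitz
  constant.\<close>

lemma pqd_lipschitz_cov:
  fixes f g :: "real \<Rightarrow> real"
  assumes UV: "pqd U V"
    and "random_variable borel U" "random_variable borel V"
    and "integrable M (\<lambda>x. (U x)\<^sup>2)" and "integrable M (\<lambda>x. (V x)\<^sup>2)"
    and f: "\<And>x y. \<bar>f x - f y\<bar> \<le> a * \<bar>x - y\<bar>" and g: "\<And>x y. \<bar>g x - g y\<bar> \<le> b * \<bar>x - y\<bar>"
  shows "\<bar>expectation (\<lambda>x. f (U x) * g (V x)) - expectation (\<lambda>x. f (U x)) * expectation (\<lambda>x. g (V x))\<bar>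
    \<le> a * b * (expectation (\<lambda>x. U x * V x) - expectation U * expectation V)"
proof -
  have "\<bar>- g x - - g y\<bar> \<le> b * \<bar>x - y\<bar>" for x y using g[of x y] by (simp add: abs_minus_commute)
  from pqd_lipschitz_cov_upper[OF assms(1-6) this]
  show ?thesis using pqd_lipschitz_cov_upper[OF assms] by (auto simp: abs_le_iff)
qed

lemma char_distr_eq_Complex:
  assumes [measurable]: "random_variable borel X"
  shows "char (distr M borel X) t = Complex (expectation (\<lambda>x. cos (t * X x))) (expectation (\<lambda>x. sin (t * X x)))"
proof -
  have i: "integrable M (\<lambda>x. cos (t * X x))" "integrable M (\<lambda>x. sin (t * X x))"
    by (auto intro!: integrable_const_bound[where B=1])
  have "char (distr M borel X) t = (CLINT x|M. complex_of_real (cos (t * X x)) + \<i> * complex_of_real (sin (t * X x)))"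
    unfolding char_def by (subst integral_distr) (auto simp: exp_Euler simp flip: cos_of_real sin_of_real)
  also have "\<dots> = complex_of_real (expectation (\<lambda>x. cos (t * X x))) + \<i> * complex_of_real (expectation (\<lambda>x. sin (t * X x)))"
    using i by simp
  finally show ?thesis by (simp add: complex_eq_iff)
qed

lemma norm_char_distr_le_1:
  assumes [measurable]: "random_variable borel X"
  shows "norm (char (distr M borel X) t) \<le> 1"
proof -
  interpret D: real_distribution "distr M borel X" by (rule real_distribution_distr) simp
  show ?thesis by (rule D.cmod_char_le_1)
qed

text \<open>By the addition formulas the real and the imaginary part of the difference are each a
  combination of two covariances of \<open>cos\<close> and \<open>sin\<close> terms. All four are at
  most t^2 Cov(U, V), whence the constant 4.\<close>

lemma pqd_char_add:
  assumes UV: "pqd U V"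
    and [measurable]: "random_variable borel U" "random_variable borel V"
    and sq: "integrable M (\<lambda>x. (U x)\<^sup>2)" "integrable M (\<lambda>x. (V x)\<^sup>2)"
  shows "norm (char (distr M borel (\<lambda>x. U x + V x)) t - char (distr M borel U) t * char (distr M borel V) t)
    \<le> 4 * t\<^sup>2 * (expectation (\<lambda>x. U x * V x) - expectation U * expectation V)"
proof -
  let ?C = "\<lambda>f g :: real \<Rightarrow> real. expectation (\<lambda>x. f (U x) * g (V x)) - expectation (\<lambda>x. f (U x)) * expectation (\<lambda>x. g (V x))"
  let ?c = "\<lambda>x::real. cos (t * x)" and ?s = "\<lambda>x::real. sin (t * x)"
  have lip: "\<bar>?c x - ?c y\<bar> \<le> \<bar>t\<bar> * \<bar>x - y\<bar>" "\<bar>?s x - ?s y\<bar> \<le> \<bar>t\<bar> * \<bar>x - y\<bar>" for x y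
    using abs_cos_diff_le[of "t*x" "t*y"] abs_sin_diff_le[of "t*x" "t*y"]
    by (simp_all add: right_diff_distrib[symmetric] abs_mult)
  note N = pqd_lipschitz_cov[OF UV assms(2,3) sq]
  note N4 = N[OF lip(1) lip(1)] N[OF lip(2) lip(2)] N[OF lip(1) lip(2)] N[OF lip(2) lip(1)]
  have bd: "integrable M (\<lambda>x. ?c (U x) * ?c (V x))" "integrable M (\<lambda>x. ?s (U x) * ?s (V x))"
    "integrable M (\<lambda>x. ?c (U x) * ?s (V x))" "integrable M (\<lambda>x. ?s (U x) * ?c (V x))"
    by (auto intro!: integrable_const_bound[where B=1] AE_I2 mult_le_one simp: abs_mult)
  have "Re (char (distr M borel (\<lambda>x. U x + V x)) t - char (distr M borel U) t * char (distr M borel V) t)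
    = ?C ?c ?c - ?C ?s ?s"
    using bd by (simp add: char_distr_eq_Complex distrib_left cos_add)
  moreover have "Im (char (distr M borel (\<lambda>x. U x + V x)) t - char (distr M borel U) t * char (distr M borel V) t)
    = ?C ?c ?s + ?C ?s ?c"
    using bd by (simp add: char_distr_eq_Complex distrib_left sin_add)
  ultimately show ?thesis
    using N4 cmod_le[of "char (distr M borel (\<lambda>x. U x + V x)) t - char (distr M borel U) t * char (distr M borel V) t"]
    by (simp add: power2_eq_square)
qed

end

section \<open>Central limit theorem for dependent stationary sequences\<close>

text \<open>This is the classical central limit theorem for k n independent copies of X, scaled by
  sqrt n: in the block argument k n is the number of full blocks among n terms, and
  \<open>\<kappa>\<close> is the inverse block length.\<close>

lemma (in prob_space) char_distr_power_tendsto: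
  fixes X :: "'a \<Rightarrow> real"
  assumes [measurable]: "random_variable borel X"
    and X2: "integrable M (\<lambda>x. (X x)\<^sup>2)" and X0: "expectation X = 0"
    and k: "(\<lambda>n. real (k n) / real n) \<longlonglongrightarrow> \<kappa>"
  shows "(\<lambda>n. char (distr M borel X) (t / sqrt (real n)) ^ k n)
    \<longlonglongrightarrow> complex_of_real (exp (- (t\<^sup>2 * expectation (\<lambda>x. (X x)\<^sup>2) * \<kappa> / 2)))"
proof -
  define v where "v = expectation (\<lambda>x. (X x)\<^sup>2)"
  define r where "r n = t / sqrt (real n)" for n
  define x where "x n = (r n)\<^sup>2 * v / 2" for n
  \<comment> \<open>Remainder of the second-order Taylor expansion. The quadratic entry of the
    minimum is an integrable majorant, the cubic one tends to 0 with r.\<close>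
  define E where "E n = expectation (\<lambda>\<omega>. min (6 * (X \<omega>)\<^sup>2) (\<bar>r n\<bar> * \<bar>X \<omega>\<bar> ^ 3))" for n
  have v0: "v \<ge> 0" unfolding v_def by simp
  have Xi: "integrable M X" using X2 by (auto intro: square_integrable_imp_integrable)
  have r0: "r \<longlonglongrightarrow> 0" unfolding r_def
    by (rule tendsto_divide_0[OF tendsto_const])
      (auto intro!: filterlim_at_top_imp_at_infinity filterlim_compose[OF sqrt_at_top] filterlim_real_sequentially)
  have r2: "(r n)\<^sup>2 = t\<^sup>2 / real n" for n by (simp add: r_def power_divide)
  have kr: "(\<lambda>n. real (k n) * (r n)\<^sup>2) \<longlonglongrightarrow> t\<^sup>2 * \<kappa>"
    using tendsto_mult_left[OF k, of "t\<^sup>2"] by (simp add: r2 mult.commute)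
  have x0: "x n \<ge> 0" for n using v0 by (simp add: x_def)
  have xlim: "x \<longlonglongrightarrow> 0" unfolding x_def using r0 by (auto intro!: tendsto_eq_intros)
  have E0: "E \<longlonglongrightarrow> 0"
  proof -
    have "E \<longlonglongrightarrow> expectation (\<lambda>\<omega>. 0)" unfolding E_def
    proof (rule integral_dominated_convergence[where w="\<lambda>\<omega>. 6 * (X \<omega>)\<^sup>2"])
      show "AE \<omega> in M. (\<lambda>n. min (6 * (X \<omega>)\<^sup>2) (\<bar>r n\<bar> * \<bar>X \<omega>\<bar> ^ 3)) \<longlonglongrightarrow> 0"
        using r0 by (auto intro!: AE_I2 tendsto_eq_intros simp: min_absorb2)
    qed (use X2 in auto)
    thus ?thesis by simp
  qed
  have exp_bound: "\<bar>(1 - y) - exp (- y)\<bar> \<le> y\<^sup>2" if "y \<ge> 0" for y :: real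
  proof -
    have "1 - y \<le> exp (- y)" using exp_ge_add_one_self[of "-y"] by simp
    moreover have "exp (- y) \<le> 1 - y + y\<^sup>2"
    proof -
      have "exp (- y) \<le> 1 / (1 + y)" using exp_ge_add_one_self[of y] that 
        by (simp add: exp_minus field_simps)
      \<comment> \<open>Because (1 - y + y^2) * (1 + y) = 1 + y^3 \<ge> 1.\<close>
      also have "\<dots> \<le> 1 - y + y\<^sup>2" using that by (simp add: field_simps power2_eq_square)
      finally show ?thesis .
    qed
    ultimately show ?thesis by simp
  qed
  have main: "norm (char (distr M borel X) (r n) ^ k n - complex_of_real (exp (- x n)) ^ k n)
    \<le> real (k n) * (r n)\<^sup>2 * (E n / 6) + real (k n) * (r n)\<^sup>2 * (v / 2 * x n)" for n
  proof -
    \<comment> \<open>For numbers of modulus at most 1, k-th powers are at most k times as far apart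
      as the numbers. It remains to make the distance o(1/n), that is, small compared with the
      square of r n.\<close>
    have "norm (char (distr M borel X) (r n) ^ k n - complex_of_real (exp (- x n)) ^ k n)
      \<le> real (k n) * norm (char (distr M borel X) (r n) - complex_of_real (exp (- x n)))"
      by (rule norm_power_diff) (auto intro!: norm_char_distr_le_1 simp: x0)
    also have "norm (char (distr M borel X) (r n) - complex_of_real (exp (- x n)))
      \<le> (r n)\<^sup>2 * (E n / 6) + (r n)\<^sup>2 * (v / 2 * x n)"
    proof -
      have "variance X = v" using X0 by (simp add: v_def)
      from char_approx3'[OF assms(1) Xi X2 X0 this refl, of "r n"]
      have "norm (char (distr M borel X) (r n) - complex_of_real (1 - x n)) \<le> (r n)\<^sup>2 * (E n / 6)"
        by (simp add: x_def E_def)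
      moreover have "norm (complex_of_real (1 - x n) - complex_of_real (exp (- x n))) \<le> (r n)\<^sup>2 * (v / 2 * x n)"
        using exp_bound[OF x0[of n]] unfolding of_real_diff[symmetric] norm_of_real
        by (simp add: x_def power2_eq_square mult_ac)
      moreover have "norm (char (distr M borel X) (r n) - complex_of_real (exp (- x n)))
        \<le> norm (char (distr M borel X) (r n) - complex_of_real (1 - x n))
          + norm (complex_of_real (1 - x n) - complex_of_real (exp (- x n)))"
        by (rule order_trans[OF _ norm_triangle_ineq]) simp
      ultimately show ?thesis by linarith
    qed
    finally show ?thesis by (simp add: mult_left_mono distrib_left mult.assoc)
  qed
  have "(\<lambda>n. real (k n) * (r n)\<^sup>2 * (E n / 6) + real (k n) * (r n)\<^sup>2 * (v / 2 * x n)) \<longlonglongrightarrow> 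
     t\<^sup>2 * \<kappa> * (0 / 6) + t\<^sup>2 * \<kappa> * (v / 2 * 0)"
    by (intro tendsto_add tendsto_mult[OF kr] tendsto_divide[OF E0 tendsto_const] tendsto_mult_left xlim) simp
  hence "(\<lambda>n. real (k n) * (r n)\<^sup>2 * (E n / 6) + real (k n) * (r n)\<^sup>2 * (v / 2 * x n)) \<longlonglongrightarrow> 0" by simp
  hence 1: "(\<lambda>n. char (distr M borel X) (r n) ^ k n - complex_of_real (exp (- x n)) ^ k n) \<longlonglongrightarrow> 0"
    by (rule Lim_null_comparison[OF always_eventually[OF allI[OF main]]])
  have "(\<lambda>n. exp (- (real (k n) * (r n)\<^sup>2 * v / 2))) \<longlonglongrightarrow> exp (- (t\<^sup>2 * \<kappa> * v / 2))"
    by (intro tendsto_exp tendsto_minus tendsto_divide tendsto_mult[OF kr] tendsto_const) simp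
  hence 2: "(\<lambda>n. complex_of_real (exp (- x n)) ^ k n) \<longlonglongrightarrow> complex_of_real (exp (- (t\<^sup>2 * \<kappa> * v / 2)))"
    unfolding of_real_power[symmetric] exp_of_nat_mult[symmetric] x_def
    by (intro tendsto_of_real) (simp add: mult.assoc)
  from tendsto_add[OF 1 2] show ?thesis by (simp add: r_def v_def mult_ac)
qed

text \<open>The factor 2 collects real and imaginary part. The first absolute moment of U - V is
  passed to the second through nonnegativity of the variance of |U - V|.\<close>

lemma (in prob_space) norm_char_distr_diff_le:
  assumes [measurable]: "random_variable borel U" "random_variable borel V"
    and i2: "integrable M (\<lambda>x. (U x - V x)\<^sup>2)"
  shows "norm (char (distr M borel U) t - char (distr M borel V) t)
    \<le> 2 * \<bar>t\<bar> * sqrt (expectation (\<lambda>x. (U x - V x)\<^sup>2))"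
proof -
  have i: "integrable M (\<lambda>x. \<bar>U x - V x\<bar>)"
    using i2 by (intro integrable_abs square_integrable_imp_integrable[OF _ i2]) measurable
  have "(expectation (\<lambda>x. \<bar>U x - V x\<bar>))\<^sup>2 \<le> expectation (\<lambda>x. (U x - V x)\<^sup>2)"
    using variance_eq[of "\<lambda>x. \<bar>U x - V x\<bar>"] variance_positive[of "\<lambda>x. \<bar>U x - V x\<bar>"] i i2 by simp
  hence E: "expectation (\<lambda>x. \<bar>U x - V x\<bar>) \<le> sqrt (expectation (\<lambda>x. (U x - V x)\<^sup>2))"
    by (rule real_le_rsqrt)
  have *: "\<bar>expectation (\<lambda>x. h (U x)) - expectation (\<lambda>x. h (V x))\<bar> \<le> \<bar>t\<bar> * expectation (\<lambda>x. \<bar>U x - V x\<bar>)"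
    if h: "\<And>x y. \<bar>h x - h y\<bar> \<le> \<bar>t\<bar> * \<bar>x - y\<bar>" "\<And>x. \<bar>h x\<bar> \<le> 1" for h :: "real \<Rightarrow> real"
  proof -
    note lipschitz_borel_measurable[OF h(1), measurable]
    have [simp]: "integrable M (\<lambda>x. h (U x))" "integrable M (\<lambda>x. h (V x))"
      by (auto intro!: integrable_const_bound[where B=1] AE_I2 h)
    have "\<bar>expectation (\<lambda>x. h (U x)) - expectation (\<lambda>x. h (V x))\<bar> = \<bar>expectation (\<lambda>x. h (U x) - h (V x))\<bar>"
      by simp
    also have "\<dots> \<le> expectation (\<lambda>x. \<bar>h (U x) - h (V x)\<bar>)" by (rule integral_abs_bound)
    also have "\<dots> \<le> expectation (\<lambda>x. \<bar>t\<bar> * \<bar>U x - V x\<bar>)"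
      by (intro integral_mono h) (use i in auto)
    finally show ?thesis by simp
  qed
  have "\<bar>cos (t * x) - cos (t * y)\<bar> \<le> \<bar>t\<bar> * \<bar>x - y\<bar>" "\<bar>sin (t * x) - sin (t * y)\<bar> \<le> \<bar>t\<bar> * \<bar>x - y\<bar>" for x y
    using abs_cos_diff_le[of "t*x" "t*y"] abs_sin_diff_le[of "t*x" "t*y"]
    by (simp_all add: right_diff_distrib[symmetric] abs_mult)
  from *[OF this(1)] *[OF this(2)]
  have "norm (char (distr M borel U) t - char (distr M borel V) t) \<le> 2 * \<bar>t\<bar> * expectation (\<lambda>x. \<bar>U x - V x\<bar>)"
    using cmod_le[of "char (distr M borel U) t - char (distr M borel V) t"]
    by (simp add: char_distr_eq_Complex)
  also have "\<dots> \<le> 2 * \<bar>t\<bar> * sqrt (expectation (\<lambda>x. (U x - V x)\<^sup>2))"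
    by (intro mult_left_mono E) auto
  finally show ?thesis .
qed

text \<open>Newman's linear positive quadrant dependence with coefficients 0 and 1, but with index
  sets that may overlap: the block argument compares disjoint sums, the almost sure part compares S
  j with S k, one of which contains the other.\<close>

locale lpqd_process = prob_space +
  fixes Y :: "nat \<Rightarrow> 'a \<Rightarrow> real"
  assumes rv [measurable]: "random_variable borel (Y k)"
    and sq: "integrable M (\<lambda>\<omega>. (Y k \<omega>)\<^sup>2)"
    and mean: "expectation (Y k) = 0"
    and lpqd: "finite A \<Longrightarrow> finite B \<Longrightarrow> pqd (\<lambda>\<omega>. \<Sum>k\<in>A. Y k \<omega>) (\<lambda>\<omega>. \<Sum>k\<in>B. Y k \<omega>)"
    and stationary: "finite A \<Longrightarrow>
      distr M borel (\<lambda>\<omega>. \<Sum>k\<in>A. Y (k + h) \<omega>) = distr M borel (\<lambda>\<omega>. \<Sum>k\<in>A. Y k \<omega>)"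
    and summable_cov: "summable (\<lambda>k. expectation (\<lambda>\<omega>. Y 0 \<omega> * Y k \<omega>))"
begin

definition \<gamma> where "\<gamma> k = expectation (\<lambda>\<omega>. Y 0 \<omega> * Y k \<omega>)"
definition \<Gamma> where "\<Gamma> = (\<Sum>k. \<gamma> k)"
text \<open>\<open>\<Gamma>\<close> includes lag 0, so this is the usual long-run variance: the
  variance plus twice the covariances at positive lags.\<close>

definition asym_var where "asym_var = 2 * \<Gamma> - \<gamma> 0"
definition S where "S n \<omega> = (\<Sum>k<n. Y k \<omega>)"
definition v where "v n = expectation (\<lambda>\<omega>. (S n \<omega>)\<^sup>2)"

section \<open>Covariances and growth of the variance of partial sums\<close>

lemma rv_S [measurable]: "random_variable borel (S n)" unfolding S_def by measurable
lemma sq_S: "integrable M (\<lambda>\<omega>. (S n \<omega>)\<^sup>2)" unfolding S_def by (intro integrable_square_sum rv sq)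
lemma int_Y: "integrable M (Y k)" by (rule square_integrable_imp_integrable[OF rv sq])
lemma int_YY: "integrable M (\<lambda>\<omega>. Y i \<omega> * Y j \<omega>)" by (rule integrable_mult_of_squares[OF rv rv sq sq])
lemma int_SY: "integrable M (\<lambda>\<omega>. S i \<omega> * Y j \<omega>)" by (rule integrable_mult_of_squares[OF rv_S rv sq_S sq])
lemma mean_S: "expectation (S n) = 0" unfolding S_def using int_Y mean by simp

lemma \<gamma>_nonneg: "\<gamma> k \<ge> 0"
proof -
  have "pqd (Y 0) (Y k)" using lpqd[of "{0}" "{k}"] by simp
  from pqd_expectation_mult[OF this, of id id] show ?thesis
    using sq by (simp add: \<gamma>_def mean mono_def)
qed

lemma \<Gamma>_ge: "finite A \<Longrightarrow> sum \<gamma> A \<le> \<Gamma>"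
  unfolding \<Gamma>_def using summable_cov \<gamma>_nonneg by (auto intro!: sum_le_suminf simp: \<gamma>_def[abs_def])

lemma \<Gamma>_nonneg: "\<Gamma> \<ge> 0" using \<Gamma>_ge[of "{}"] by simp

text \<open>Stationarity is stated for laws of sums, so the covariance is recovered by polarization
  from the second moment of a sum of two terms. At d = 0 the set {0, d} collapses to a point, hence
  the case split.\<close>

lemma cov_Y_shift: "expectation (\<lambda>\<omega>. Y i \<omega> * Y (i + d) \<omega>) = \<gamma> d"
proof -
  have sqd: "expectation (\<lambda>\<omega>. (\<Sum>k\<in>A. Y (k + h) \<omega>)\<^sup>2) = expectation (\<lambda>\<omega>. (\<Sum>k\<in>A. Y k \<omega>)\<^sup>2)"
    if "finite A" for A h
    using arg_cong[OF stationary[OF that, of h], of "\<lambda>N. (LINT x|N. x\<^sup>2)"]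
    by (simp add: integral_distr)
  have s1: "expectation (\<lambda>\<omega>. (Y i \<omega>)\<^sup>2) = expectation (\<lambda>\<omega>. (Y 0 \<omega>)\<^sup>2)" for i
    using sqd[of "{0}" i] by simp
  show ?thesis
  proof (cases "d = 0")
    case True
    thus ?thesis using s1[of i] by (simp add: \<gamma>_def power2_eq_square)
  next
    case False
    have ex: "expectation (\<lambda>\<omega>. (Y a \<omega> + Y b \<omega>)\<^sup>2) = expectation (\<lambda>\<omega>. (Y 0 \<omega>)\<^sup>2)
      + expectation (\<lambda>\<omega>. (Y 0 \<omega>)\<^sup>2) + 2 * expectation (\<lambda>\<omega>. Y a \<omega> * Y b \<omega>)" for a b
      using int_YY[of a b] sq by (simp add: power2_sum s1[of a] s1[of b] mult.assoc)
    show ?thesis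
      using sqd[of "{0,d}" i] ex[of i "i+d"] ex[of 0 d] False by (simp add: add.commute \<gamma>_def)
  qed
qed

lemma cov_Y: "expectation (\<lambda>\<omega>. Y i \<omega> * Y j \<omega>) = \<gamma> (if i \<le> j then j - i else i - j)"
  using cov_Y_shift[of i "j - i"] cov_Y_shift[of j "i - j"] by (auto simp: mult.commute)

text \<open>In row i the lags on either side of the diagonal are distinct, so each side sums to at
  most \<open>\<Gamma>\<close>. The bound involves j alone; divided by sqrt j * sqrt k it leaves
  sqrt (j / k).\<close>

lemma cov_S_le: "expectation (\<lambda>\<omega>. S j \<omega> * S k \<omega>) \<le> real j * (2 * \<Gamma>)"
proof -
  have "expectation (\<lambda>\<omega>. S j \<omega> * S k \<omega>) = (\<Sum>i<j. \<Sum>l<k. expectation (\<lambda>\<omega>. Y i \<omega> * Y l \<omega>))"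
    unfolding S_def sum_product using int_YY by simp
  also have "\<dots> \<le> (\<Sum>i<j. 2 * \<Gamma>)"
  proof (rule sum_mono)
    fix i
    have "(\<Sum>l<k. expectation (\<lambda>\<omega>. Y i \<omega> * Y l \<omega>)) = (\<Sum>l\<in>{..<k} \<inter> {..i}. \<gamma> (i - l)) + (\<Sum>l\<in>{..<k} \<inter> {i<..}. \<gamma> (l - i))"
    proof -
      have "(\<Sum>l<k. expectation (\<lambda>\<omega>. Y i \<omega> * Y l \<omega>)) = 
        (\<Sum>l\<in>({..<k} \<inter> {..i}) \<union> ({..<k} \<inter> {i<..}). expectation (\<lambda>\<omega>. Y i \<omega> * Y l \<omega>))"
        by (intro sum.cong) auto
      also have "\<dots> = (\<Sum>l\<in>{..<k} \<inter> {..i}. expectation (\<lambda>\<omega>. Y i \<omega> * Y l \<omega>))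
        + (\<Sum>l\<in>{..<k} \<inter> {i<..}. expectation (\<lambda>\<omega>. Y i \<omega> * Y l \<omega>))"
        by (rule sum.union_disjoint) auto
      also have "(\<Sum>l\<in>{..<k} \<inter> {..i}. expectation (\<lambda>\<omega>. Y i \<omega> * Y l \<omega>)) = (\<Sum>l\<in>{..<k} \<inter> {..i}. \<gamma> (i - l))"
        by (intro sum.cong) (auto simp: cov_Y)
      also have "(\<Sum>l\<in>{..<k} \<inter> {i<..}. expectation (\<lambda>\<omega>. Y i \<omega> * Y l \<omega>)) = (\<Sum>l\<in>{..<k} \<inter> {i<..}. \<gamma> (l - i))"
        by (intro sum.cong) (auto simp: cov_Y)
      finally show ?thesis .
    qed
    also have "(\<Sum>l\<in>{..<k} \<inter> {..i}. \<gamma> (i - l)) = sum \<gamma> ((\<lambda>l. i - l) ` ({..<k} \<inter> {..i}))"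
      by (subst sum.reindex) (auto simp: inj_on_def)
    also have "\<dots> \<le> \<Gamma>" by (rule \<Gamma>_ge) auto
    also have "(\<Sum>l\<in>{..<k} \<inter> {i<..}. \<gamma> (l - i)) = sum \<gamma> ((\<lambda>l. l - i) ` ({..<k} \<inter> {i<..}))"
      by (subst sum.reindex) (auto simp: inj_on_def)
    also have "\<dots> \<le> \<Gamma>" by (rule \<Gamma>_ge) auto
    finally show "(\<Sum>l<k. expectation (\<lambda>\<omega>. Y i \<omega> * Y l \<omega>)) \<le> 2 * \<Gamma>" by simp
  qed
  finally show ?thesis by simp
qed

lemma v_le: "v n \<le> real n * (2 * \<Gamma>)"
  using cov_S_le[of n n] by (simp add: v_def power2_eq_square)

text \<open>The increments converge to \<open>asym_var\<close>, so v n / n converges as their Cesaro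
  mean.\<close>

lemma v_Suc: "v (Suc n) = v n + (2 * (\<Sum>k<Suc n. \<gamma> k) - \<gamma> 0)"
proof -
  have "v (Suc n) = v n + \<gamma> 0 + 2 * expectation (\<lambda>\<omega>. S n \<omega> * Y n \<omega>)"
    using sq_S[of n] sq[of n] int_SY[of n n] cov_Y_shift[of n 0]
    by (simp add: v_def S_def power2_sum power2_eq_square[of "Y n _"] mult.assoc)
  also have "expectation (\<lambda>\<omega>. S n \<omega> * Y n \<omega>) = (\<Sum>i<n. \<gamma> (n - i))"
    unfolding S_def sum_distrib_right using int_YY by (simp add: cov_Y)
  also have "\<dots> = (\<Sum>k<n. \<gamma> (Suc k))"
    by (rule sum.reindex_bij_witness[of _ "\<lambda>k. n - Suc k" "\<lambda>k. n - Suc k"]) (auto simp: Suc_diff_Suc)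
  finally show ?thesis by (simp only: sum.lessThan_Suc_shift) simp
qed

lemma v_over_n_tendsto: "(\<lambda>n. v n / real n) \<longlonglongrightarrow> asym_var"
proof -
  have "v n = (\<Sum>m<n. 2 * (\<Sum>k<Suc m. \<gamma> k) - \<gamma> 0)" for n
    by (induction n) (simp_all add: v_Suc, simp add: v_def S_def)
  moreover have "(\<lambda>m. 2 * (\<Sum>k<Suc m. \<gamma> k) - \<gamma> 0) \<longlonglongrightarrow> asym_var"
    unfolding asym_var_def \<Gamma>_def
    by (intro tendsto_intros LIMSEQ_Suc summable_LIMSEQ) (use summable_cov in \<open>simp add: \<gamma>_def[abs_def]\<close>)
  ultimately show ?thesis using cesaro_tendsto by simp
qed

lemma asym_var_ge: "asym_var \<ge> \<gamma> 0"
  unfolding asym_var_def using \<Gamma>_ge[of "{0}"] by simp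

text \<open>Splitting off one block costs 4 r^2 times its covariance with the preceding sum, and
  twice that covariance is exactly v (m * Suc k) - v (m * k) - v m. The errors telescope to the
  stated bound.\<close>

lemma norm_char_block_diff:
  "norm (char (distr M borel (S (m * k))) r - char (distr M borel (S m)) r ^ k)
    \<le> 2 * r\<^sup>2 * (v (m * k) - real k * v m)"
proof (induction k)
  case 0
  have "S 0 = (\<lambda>_. 0)" by (auto simp: S_def)
  thus ?case by (simp add: v_def char_distr_eq_Complex prob_space Complex_eq_1 del: distr_const)
next
  case (Suc k)
  define B where "B \<omega> = (\<Sum>i<m. Y (i + m * k) \<omega>)" for \<omega>
  have [measurable]: "random_variable borel B" unfolding B_def by measurable
  have sqB: "integrable M (\<lambda>\<omega>. (B \<omega>)\<^sup>2)" unfolding B_def by (intro integrable_square_sum rv sq)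
  have B_eq: "B = (\<lambda>\<omega>. \<Sum>i\<in>{m*k..<m*k+m}. Y i \<omega>)"
    unfolding B_def
    by (intro ext sum.reindex_bij_witness[of _ "\<lambda>i. i - m * k" "\<lambda>i. i + m * k"]) auto
  have S_add: "S (m * Suc k) = (\<lambda>\<omega>. S (m * k) \<omega> + B \<omega>)"
    unfolding S_def B_eq lessThan_atLeast0
    by (auto simp: sum.atLeastLessThan_concat add.commute)
  have dB: "distr M borel B = distr M borel (S m)"
    unfolding B_def[abs_def] S_def[abs_def] by (rule stationary) simp
  have vB: "expectation (\<lambda>\<omega>. (B \<omega>)\<^sup>2) = v m"
    using arg_cong[OF dB, of "\<lambda>N. (LINT x|N. x\<^sup>2)"] by (simp add: integral_distr v_def)
  have iSB: "integrable M (\<lambda>\<omega>. S (m * k) \<omega> * B \<omega>)"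
    by (rule integrable_mult_of_squares[OF _ _ sq_S sqB]) measurable
  have v_eq: "v (m * Suc k) = v (m * k) + v m + 2 * expectation (\<lambda>\<omega>. S (m * k) \<omega> * B \<omega>)"
    unfolding S_add v_def[of "m * Suc k"] using sq_S[of "m*k"] sqB iSB vB
    by (simp add: power2_sum v_def mult.assoc)
  have "pqd (S (m * k)) B"
    unfolding S_def[abs_def] B_eq by (rule lpqd) auto
  from pqd_char_add[OF this _ _ sq_S sqB, of r]
  have 1: "norm (char (distr M borel (S (m * Suc k))) r - char (distr M borel (S (m * k))) r * char (distr M borel (S m)) r)
      \<le> 4 * r\<^sup>2 * expectation (\<lambda>\<omega>. S (m * k) \<omega> * B \<omega>)"
    unfolding S_add by (simp add: dB mean_S)
  \<comment> \<open>The factor of the new block has modulus at most 1, so the earlier error is not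
    amplified.\<close>
  have 2: "norm (char (distr M borel (S (m * k))) r * char (distr M borel (S m)) r - char (distr M borel (S m)) r ^ Suc k)
     \<le> norm (char (distr M borel (S (m * k))) r - char (distr M borel (S m)) r ^ k)"
  proof -
    have "char (distr M borel (S (m * k))) r * char (distr M borel (S m)) r - char (distr M borel (S m)) r ^ Suc k
      = (char (distr M borel (S (m * k))) r - char (distr M borel (S m)) r ^ k) * char (distr M borel (S m)) r"
      by (simp add: algebra_simps)
    thus ?thesis using norm_char_distr_le_1[OF rv_S] by (simp add: norm_mult mult_left_le)
  qed
  have "norm (char (distr M borel (S (m * Suc k))) r - char (distr M borel (S m)) r ^ Suc k)
    \<le> 4 * r\<^sup>2 * expectation (\<lambda>\<omega>. S (m * k) \<omega> * B \<omega>) + 2 * r\<^sup>2 * (v (m * k) - real k * v m)"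
    using norm_triangle_le[OF add_mono[OF 1 order_trans[OF 2 Suc.IH]]] by simp
  also have "\<dots> = 2 * r\<^sup>2 * (v (m * Suc k) - real (Suc k) * v m)"
    unfolding v_eq by (simp add: algebra_simps)
  finally show ?case .
qed

definition T where "T n \<omega> = S n \<omega> / sqrt (real n)"

lemma rv_T [measurable]: "random_variable borel (T n)" unfolding T_def by measurable

lemma char_T: "char (distr M borel (T n)) t = char (distr M borel (S n)) (t / sqrt (real n))"
  by (simp add: char_def integral_distr T_def)

lemma char_T_tendsto:
  "(\<lambda>n. char (distr M borel (T n)) t) \<longlonglongrightarrow> complex_of_real (exp (- (t\<^sup>2 * asym_var / 2)))"
proof (rule LIM_zero_cancel, rule tendsto_norm_zero_cancel)
  define L where "L = complex_of_real (exp (- (t\<^sup>2 * asym_var / 2)))"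
  define Lm where "Lm m = complex_of_real (exp (- (t\<^sup>2 * (v m / real m) / 2)))" for m
  \<comment> \<open>Asymptotic error for blocks of fixed length m: the first summand comes from
    dependence between blocks, the second from the variance of a single block.\<close>
  define \<delta> where "\<delta> m = 2 * t\<^sup>2 * (asym_var - v m / real m) + norm (Lm m - L)" for m
  have \<delta>0: "\<delta> \<longlonglongrightarrow> 0"
  proof -
    have "\<delta> \<longlonglongrightarrow> 2 * t\<^sup>2 * (asym_var - asym_var) + norm (L - L)"
      unfolding \<delta>_def Lm_def L_def by (intro tendsto_intros v_over_n_tendsto) simp_all
    thus ?thesis by simp
  qed
  define e where "e n = norm (char (distr M borel (T n)) t - L)" for n
  have ex: "\<exists>b. b \<longlonglongrightarrow> \<delta> m \<and> (\<forall>\<^sub>F n in sequentially. e n \<le> b n)" if m: "m > 0" for m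
  proof -
    define k where "k n = n div m" for n
    define r where "r n = t / sqrt (real n)" for n
    \<comment> \<open>\<open>b1\<close> pays for the incomplete last block of fewer than m terms,
      \<open>b2\<close> for decoupling the full blocks, \<open>b3\<close> for the central limit
      theorem with independent blocks.\<close>
    define b1 where "b1 n = 2 * \<bar>r n\<bar> * sqrt (real m * (2 * \<Gamma>))" for n
    define b2 where "b2 n = 2 * (r n)\<^sup>2 * (v (m * k n) - real (k n) * v m)" for n
    define b3 where "b3 n = norm (char (distr M borel (S m)) (r n) ^ k n - Lm m)" for n
    have r0: "r \<longlonglongrightarrow> 0" unfolding r_def
      by (rule tendsto_divide_0[OF tendsto_const])
        (auto intro!: filterlim_at_top_imp_at_infinity filterlim_compose[OF sqrt_at_top] filterlim_real_sequentially)
    have k_lim: "(\<lambda>n. real (k n) / real n) \<longlonglongrightarrow> 1 / real m"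
    proof (rule real_tendsto_sandwich)
      show "\<forall>\<^sub>F n in sequentially. 1 / real m - 1 / real n \<le> real (k n) / real n"
        using eventually_gt_at_top[of 0]
      proof eventually_elim
        case (elim n)
        have "real n - real m \<le> real (m * k n)"
          using mult_div_mod_eq[of m n] mod_less_divisor[OF m, of n] unfolding k_def by linarith
        hence "(real n - real m) / (real m * real n) \<le> real (m * k n) / (real m * real n)"
          by (intro divide_right_mono) auto
        thus ?case using elim m by (simp add: diff_divide_distrib)
      qed
      show "\<forall>\<^sub>F n in sequentially. real (k n) / real n \<le> 1 / real m"
        using eventually_gt_at_top[of 0]
      proof eventually_elim
        case (elim n)
        have "real (m * k n) \<le> real n" unfolding k_def by (simp del: of_nat_mult)
        thus ?case using elim m by (simp add: field_simps)
      qed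
      show "(\<lambda>n. 1 / real m - 1 / real n) \<longlonglongrightarrow> 1 / real m"
        using tendsto_diff[OF tendsto_const lim_1_over_n, of "1 / real m"] by simp
    qed simp
    have k_top: "filterlim (\<lambda>n. m * k n) at_top sequentially"
      unfolding filterlim_at_top
    proof
      fix Z
      show "\<forall>\<^sub>F n in sequentially. Z \<le> m * k n"
        using eventually_ge_at_top[of "Z + m"]
      proof eventually_elim
        case (elim n)
        thus ?case using mult_div_mod_eq[of m n] mod_less_divisor[OF m, of n] unfolding k_def by linarith
      qed
    qed
    have b1_lim: "b1 \<longlonglongrightarrow> 0"
      unfolding b1_def using r0 by (auto intro!: tendsto_eq_intros)
    have b3_lim: "b3 \<longlonglongrightarrow> 0"
    proof -
      have "(\<lambda>n. char (distr M borel (S m)) (r n) ^ k n) \<longlonglongrightarrow> Lm m"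
        using char_distr_power_tendsto[OF rv_S sq_S mean_S k_lim, of m t]
        by (simp add: r_def Lm_def v_def)
      thus ?thesis unfolding b3_def using LIM_zero tendsto_norm_zero by blast
    qed
    have b2_lim: "b2 \<longlonglongrightarrow> 2 * t\<^sup>2 * (asym_var - v m / real m)"
    proof -
      \<comment> \<open>The variance is divided by its own index m * k n, so that the limit of v n /
        n applies along this subsequence; the factor k n / n is corrected for separately.\<close>
      have "(\<lambda>n. 2 * t\<^sup>2 * ((v (m * k n) / real (m * k n)) * real m * (real (k n) / real n) - (real (k n) / real n) * v m))
        \<longlonglongrightarrow> 2 * t\<^sup>2 * (asym_var * real m * (1 / real m) - 1 / real m * v m)"
        by (intro tendsto_intros k_lim filterlim_compose[OF v_over_n_tendsto k_top])
      moreover have "\<forall>\<^sub>F n in sequentially. 2 * t\<^sup>2 * ((v (m * k n) / real (m * k n)) * real m * (real (k n) / real n) - (real (k n) / real n) * v m) = b2 n"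
        using eventually_ge_at_top[of m]
      proof eventually_elim
        case (elim n)
        hence "k n > 0" "n > 0" using m by (auto simp: k_def div_greater_zero_iff)
        thus ?case using m by (simp add: b2_def r_def field_simps power_divide)
      qed
      ultimately show ?thesis using m by (auto intro: Lim_transform_eventually)
    qed
    have "e n \<le> b1 n + b2 n + b3 n + norm (Lm m - L)" for n
    proof -
      define D where "D \<omega> = (\<Sum>i<n mod m. Y (i + m * k n) \<omega>)" for \<omega>
      have D_eq: "D = (\<lambda>\<omega>. \<Sum>i\<in>{m * k n..<m * k n + n mod m}. Y i \<omega>)"
        unfolding D_def
        by (intro ext sum.reindex_bij_witness[of _ "\<lambda>i. i - m * k n" "\<lambda>i. i + m * k n"]) auto
      have S_add: "S n \<omega> - S (m * k n) \<omega> = D \<omega>" for \<omega>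
      proof -
        have "S n \<omega> = (\<Sum>i<m * k n + n mod m. Y i \<omega>)" by (simp add: S_def k_def)
        thus ?thesis unfolding S_def D_eq lessThan_atLeast0
          using sum.atLeastLessThan_concat[of 0 "m * k n" "m * k n + n mod m" "\<lambda>i. Y i \<omega>"] by simp
      qed
      have dD: "distr M borel D = distr M borel (S (n mod m))"
        unfolding D_def[abs_def] S_def[abs_def] by (rule stationary) simp
      have [measurable]: "random_variable borel D" unfolding D_def by measurable
      have vD: "expectation (\<lambda>\<omega>. (D \<omega>)\<^sup>2) = v (n mod m)"
        using arg_cong[OF dD, of "\<lambda>N. (LINT x|N. x\<^sup>2)"] by (simp add: integral_distr v_def)
      have sqD: "integrable M (\<lambda>\<omega>. (D \<omega>)\<^sup>2)" unfolding D_def by (intro integrable_square_sum rv sq)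
      have "v (n mod m) \<le> real m * (2 * \<Gamma>)"
        using v_le[of "n mod m"] mult_right_mono[of "real (n mod m)" "real m" "2 * \<Gamma>"]
          mod_less_divisor[OF m, of n] \<Gamma>_nonneg by simp
      hence "2 * \<bar>r n\<bar> * sqrt (v (n mod m)) \<le> b1 n" unfolding b1_def by (intro mult_left_mono) auto
      hence 1: "norm (char (distr M borel (S n)) (r n) - char (distr M borel (S (m * k n))) (r n)) \<le> b1 n"
        using norm_char_distr_diff_le[OF rv_S rv_S, of n "m * k n" "r n"] sqD vD by (simp add: S_add)
      have 2: "norm (char (distr M borel (S (m * k n))) (r n) - char (distr M borel (S m)) (r n) ^ k n) \<le> b2 n"
        unfolding b2_def by (rule norm_char_block_diff)
      have "char (distr M borel (T n)) t - L = (char (distr M borel (S n)) (r n) - char (distr M borel (S (m * k n))) (r n))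
        + (char (distr M borel (S (m * k n))) (r n) - char (distr M borel (S m)) (r n) ^ k n)
        + (char (distr M borel (S m)) (r n) ^ k n - Lm m) + (Lm m - L)"
        by (simp add: char_T r_def)
      thus ?thesis unfolding e_def b3_def using 1 2
        by (simp only:) (intro norm_triangle_le add_mono order_refl | assumption)+
    qed
    moreover have "(\<lambda>n. b1 n + b2 n + b3 n + norm (Lm m - L)) \<longlonglongrightarrow> 0 + 2 * t\<^sup>2 * (asym_var - v m / real m) + 0 + norm (Lm m - L)"
      by (intro tendsto_intros b1_lim b2_lim b3_lim)
    ultimately show ?thesis unfolding \<delta>_def by (intro exI[of _ "\<lambda>n. b1 n + b2 n + b3 n + norm (Lm m - L)"]) auto
  qed
  have "e \<longlonglongrightarrow> 0"
  proof (rule tendstoI)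
    fix \<epsilon> :: real assume \<epsilon>: "\<epsilon> > 0"
    have "\<forall>\<^sub>F m in sequentially. \<delta> m < \<epsilon> \<and> m > 0"
      using order_tendstoD(2)[OF \<delta>0 \<epsilon>] eventually_gt_at_top[of 0] by eventually_elim simp
    then obtain m where m: "\<delta> m < \<epsilon>" "m > 0" by (auto dest: eventually_happens)
    from ex[OF m(2)] obtain b where b: "b \<longlonglongrightarrow> \<delta> m" "\<forall>\<^sub>F n in sequentially. e n \<le> b n" by blast
    show "\<forall>\<^sub>F n in sequentially. dist (e n) 0 < \<epsilon>"
      using b(2) order_tendstoD(2)[OF b(1) m(1)] by eventually_elim (auto simp: e_def)
  qed
  thus "(\<lambda>n. norm (char (distr M borel (T n)) t - complex_of_real (exp (- (t\<^sup>2 * asym_var / 2))))) \<longlonglongrightarrow> 0"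
    unfolding e_def L_def .
qed

end

section \<open>Almost sure convergence of logarithmic averages\<close>

lemma sum_inverse_sqrt_le: "(\<Sum>j=1..n. 1 / sqrt (real j)) \<le> 2 * sqrt (real n)"
proof (induction n)
  case (Suc n)
  define a b where "a = sqrt (real n)" and "b = sqrt (real (Suc n))"
  have ab: "0 \<le> a" "a \<le> b" "b > 0" "b\<^sup>2 = a\<^sup>2 + 1" by (auto simp: a_def b_def)
  \<comment> \<open>Rationalising the difference of consecutive roots: b - a is at least 1 / (2 *
    b), so 2 * sqrt grows by at least the new term.\<close>
  have "1 = (b - a) * (b + a)" using ab(4) by (simp add: power2_eq_square algebra_simps)
  also have "\<dots> \<le> (b - a) * (2 * b)" using ab by (intro mult_left_mono) auto
  finally have "1 / b \<le> 2 * b - 2 * a" using ab by (simp add: field_simps)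
  with Suc show ?case unfolding a_def b_def by simp
qed simp

lemma harm_le_one_plus_ln: "n > 0 \<Longrightarrow> harm n \<le> 1 + ln (real n)"
  using decseqD[OF decseq_harm_diff_ln, of 0 "n - 1"] by (simp add: harm_expand)

text \<open>Expectation and series may be interchanged for nonnegative terms, so the series of
  squares has finite expectation and converges almost surely.\<close>

lemma (in prob_space) AE_tendsto_0_of_summable_square:
  fixes Z :: "nat \<Rightarrow> 'a \<Rightarrow> real"
  assumes Z [measurable]: "\<And>i. random_variable borel (Z i)" 
    and int: "\<And>i. integrable M (\<lambda>\<omega>. (Z i \<omega>)\<^sup>2)"
    and sum: "summable (\<lambda>i. expectation (\<lambda>\<omega>. (Z i \<omega>)\<^sup>2))"
  shows "AE \<omega> in M. (\<lambda>i. Z i \<omega>) \<longlonglongrightarrow> 0"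
proof -
  have "(\<integral>\<^sup>+\<omega>. (\<Sum>i. ennreal ((Z i \<omega>)\<^sup>2)) \<partial>M) = (\<Sum>i. \<integral>\<^sup>+\<omega>. ennreal ((Z i \<omega>)\<^sup>2) \<partial>M)"
    by (rule nn_integral_suminf) measurable
  also have "\<dots> = (\<Sum>i. ennreal (expectation (\<lambda>\<omega>. (Z i \<omega>)\<^sup>2)))"
    using int by (intro suminf_cong nn_integral_eq_integral) auto
  also have "\<dots> = ennreal (\<Sum>i. expectation (\<lambda>\<omega>. (Z i \<omega>)\<^sup>2))"
    by (rule suminf_ennreal2[OF _ sum]) simp
  finally have "(\<integral>\<^sup>+\<omega>. (\<Sum>i. ennreal ((Z i \<omega>)\<^sup>2)) \<partial>M) \<noteq> \<infinity>" by simp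
  hence "AE \<omega> in M. (\<Sum>i. ennreal ((Z i \<omega>)\<^sup>2)) \<noteq> \<infinity>"
    by (rule nn_integral_PInf_AE[rotated]) measurable
  thus ?thesis
  proof eventually_elim
    case (elim \<omega>)
    have "summable (\<lambda>i. (Z i \<omega>)\<^sup>2)"
      by (rule summable_suminf_not_top) (use elim in auto)
    hence "(\<lambda>i. (Z i \<omega>)\<^sup>2) \<longlonglongrightarrow> 0" by (rule summable_LIMSEQ_zero)
    from tendsto_real_sqrt[OF this] show ?case by (simp add: tendsto_rabs_zero_iff)
  qed
qed

lemma log_mean_diff: "log_mean (\<lambda>k. a k - b k) n = log_mean a n - log_mean b n"
  by (simp add: log_mean_def right_diff_distrib sum_subtractf)

lemma log_mean_mono: "(\<And>k. a k \<le> b k) \<Longrightarrow> log_mean a n \<le> log_mean b n"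
  unfolding log_mean_def
  by (cases "n = 0") (auto intro!: mult_left_mono sum_mono divide_right_mono)

lemma cts_step_lipschitz:
  assumes "a < b"
  shows "\<bar>cts_step a b x - cts_step a b y\<bar> \<le> 1 / (b - a) * \<bar>x - y\<bar>"
proof -
  \<comment> \<open>As a clamped affine function the step is no steeper than its affine
    part.\<close>
  have eq: "cts_step a b x = max 0 (min 1 ((b - x) / (b - a)))" for x
    using assms by (auto simp: cts_step_def max_def min_def field_simps)
  have "\<bar>cts_step a b x - cts_step a b y\<bar> \<le> \<bar>(b - x) / (b - a) - (b - y) / (b - a)\<bar>"
    unfolding eq by linarith
  also have "\<dots> = 1 / (b - a) * \<bar>x - y\<bar>"
    using assms by (simp add: diff_divide_distrib[symmetric] abs_divide abs_minus_commute)
  finally show ?thesis .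
qed

lemma cts_step_bounded: "a < b \<Longrightarrow> \<bar>cts_step a b x\<bar> \<le> 1"
  by (auto simp: cts_step_def)

context lpqd_process
begin

text \<open>The normalisation is absorbed into the test functions: as functions of S j and S k they
  have Lipschitz constants a / sqrt j and a / sqrt k.\<close>

lemma cov_lipschitz_T:
  fixes f :: "real \<Rightarrow> real"
  assumes f: "\<And>x y. \<bar>f x - f y\<bar> \<le> a * \<bar>x - y\<bar>" and jk: "0 < j" "0 < k"
  shows "\<bar>expectation (\<lambda>\<omega>. f (T j \<omega>) * f (T k \<omega>)) - expectation (\<lambda>\<omega>. f (T j \<omega>)) * expectation (\<lambda>\<omega>. f (T k \<omega>))\<bar>
    \<le> 2 * a\<^sup>2 * \<Gamma> * (sqrt (real j) / sqrt (real k))"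
proof -
  have lip: "\<bar>f (x / sqrt (real n)) - f (y / sqrt (real n))\<bar> \<le> a / sqrt (real n) * \<bar>x - y\<bar>" for x y n
    using f[of "x / sqrt (real n)" "y / sqrt (real n)"]
    by (simp add: diff_divide_distrib[symmetric] abs_divide)
  have "pqd (S j) (S k)" unfolding S_def[abs_def] by (rule lpqd) auto
  from pqd_lipschitz_cov[OF this rv_S rv_S sq_S sq_S lip[of _ j] lip[of _ k]]
  have "\<bar>expectation (\<lambda>\<omega>. f (T j \<omega>) * f (T k \<omega>)) - expectation (\<lambda>\<omega>. f (T j \<omega>)) * expectation (\<lambda>\<omega>. f (T k \<omega>))\<bar>
    \<le> a / sqrt (real j) * (a / sqrt (real k)) * expectation (\<lambda>\<omega>. S j \<omega> * S k \<omega>)"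
    by (simp add: T_def mean_S)
  also have "\<dots> = a\<^sup>2 / (sqrt (real j) * sqrt (real k)) * expectation (\<lambda>\<omega>. S j \<omega> * S k \<omega>)"
    by (simp add: power2_eq_square)
  also have "\<dots> \<le> a\<^sup>2 / (sqrt (real j) * sqrt (real k)) * (real j * (2 * \<Gamma>))"
    by (intro mult_left_mono cov_S_le) auto
  also have "\<dots> = 2 * a\<^sup>2 * \<Gamma> * (sqrt (real j) / sqrt (real k))"
    using jk by (simp add: field_simps)
  finally show ?thesis .
qed

text \<open>With C = 2 a^2 \<open>\<Gamma>\<close> and N = n + 1, the new term adds a cross part of
  at most 4 C / N and a square of at most C / N. The step costs 5 C / N, hence the constant 10 and
  the harmonic number.\<close>

lemma log_sum_second_moment:
  fixes f :: "real \<Rightarrow> real"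
  assumes f: "\<And>x y. \<bar>f x - f y\<bar> \<le> a * \<bar>x - y\<bar>" and f1: "\<And>x. \<bar>f x\<bar> \<le> 1"
  shows "expectation (\<lambda>\<omega>. (\<Sum>k=1..n. 1 / real k * (f (T k \<omega>) - expectation (\<lambda>\<omega>. f (T k \<omega>))))\<^sup>2)
    \<le> 10 * a\<^sup>2 * \<Gamma> * harm n"
proof (induction n)
  case 0
  show ?case by (simp add: harm_expand)
next
  case (Suc n)
  note lipschitz_borel_measurable[OF f, measurable]
  define C where "C = 2 * a\<^sup>2 * \<Gamma>"
  have C0: "C \<ge> 0" using \<Gamma>_nonneg by (simp add: C_def)
  define g where "g k \<omega> = f (T k \<omega>) - expectation (\<lambda>\<omega>. f (T k \<omega>))" for k \<omega>
  have [measurable]: "random_variable borel (g k)" for k unfolding g_def by measurable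
  have fi [simp]: "integrable M (\<lambda>\<omega>. f (T k \<omega>))" for k
    by (auto intro!: integrable_const_bound[where B=1] AE_I2 f1)
  have ffi [simp]: "integrable M (\<lambda>\<omega>. f (T j \<omega>) * f (T k \<omega>))" for j k
    by (auto intro!: integrable_const_bound[where B=1] AE_I2 mult_le_one f1 simp: abs_mult)
  have ggi: "integrable M (\<lambda>\<omega>. g j \<omega> * g k \<omega>)" for j k
    unfolding g_def by (simp add: left_diff_distrib right_diff_distrib)
  have gg: "expectation (\<lambda>\<omega>. g j \<omega> * g k \<omega>) \<le> C * (sqrt (real j) / sqrt (real k))" if "0 < j" "0 < k" for j k
  proof -
    have "expectation (\<lambda>\<omega>. g j \<omega> * g k \<omega>) = expectation (\<lambda>\<omega>. f (T j \<omega>) * f (T k \<omega>))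
      - expectation (\<lambda>\<omega>. f (T j \<omega>)) * expectation (\<lambda>\<omega>. f (T k \<omega>))"
      unfolding g_def by (simp add: left_diff_distrib right_diff_distrib prob_space)
    thus ?thesis using cov_lipschitz_T[OF f that] unfolding C_def by (simp add: abs_le_iff)
  qed
  define D where "D \<omega> = (\<Sum>k=1..n. 1 / real k * g k \<omega>)" for \<omega>
  define N where "N = real (Suc n)"
  have N1: "N \<ge> 1" by (simp add: N_def)
  have N: "N > 0" by (simp add: N_def)
  have [measurable]: "random_variable borel D" unfolding D_def by measurable
  have g2: "integrable M (\<lambda>\<omega>. (g k \<omega>)\<^sup>2)" for k using ggi[of k k] by (simp add: power2_eq_square)
  have D2: "integrable M (\<lambda>\<omega>. (D \<omega>)\<^sup>2)" unfolding D_def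
    by (intro integrable_square_sum integrable_square_cmult g2) measurable
  have Dg: "integrable M (\<lambda>\<omega>. D \<omega> * g (Suc n) \<omega>)" by (intro integrable_mult_of_squares D2 g2) measurable
  have "expectation (\<lambda>\<omega>. (\<Sum>k=1..Suc n. 1 / real k * g k \<omega>)\<^sup>2) 
    = expectation (\<lambda>\<omega>. (D \<omega>)\<^sup>2 + (2 / N * (D \<omega> * g (Suc n) \<omega>) + 1 / N\<^sup>2 * (g (Suc n) \<omega>)\<^sup>2))"
    by (simp add: D_def N_def[symmetric] power2_sum power_divide field_simps del: of_nat_Suc)
  also have "\<dots> = expectation (\<lambda>\<omega>. (D \<omega>)\<^sup>2) + (2 / N * expectation (\<lambda>\<omega>. D \<omega> * g (Suc n) \<omega>) + 1 / N\<^sup>2 * expectation (\<lambda>\<omega>. (g (Suc n) \<omega>)\<^sup>2))"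
    using D2 Dg g2[of "Suc n"] by simp
  also have "\<dots> \<le> 5 * C * harm n + (2 / N * (2 * C) + 1 / N * C)"
  proof (intro add_mono)
    show "expectation (\<lambda>\<omega>. (D \<omega>)\<^sup>2) \<le> 5 * C * harm n"
      using Suc.IH unfolding D_def g_def C_def by simp
    have "expectation (\<lambda>\<omega>. D \<omega> * g (Suc n) \<omega>) = (\<Sum>k=1..n. 1 / real k * expectation (\<lambda>\<omega>. g k \<omega> * g (Suc n) \<omega>))"
      unfolding D_def sum_distrib_right using ggi by (simp add: mult.assoc)
    \<comment> \<open>The summands are C / sqrt (k * N), and the sum of 1 / sqrt k is at most 2 *
      sqrt N: the cross expectation stays bounded although the weights 1 / k have a divergent
      sum.\<close>
    also have "\<dots> \<le> (\<Sum>k=1..n. 1 / real k * (C * (sqrt (real k) / sqrt N)))"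
      unfolding N_def by (intro sum_mono mult_left_mono gg) auto
    also have "\<dots> = (\<Sum>k=1..n. (C / sqrt N) * (1 / sqrt (real k)))"
    proof (rule sum.cong)
      fix k assume "k \<in> {1..n}"
      hence "sqrt (real k) * sqrt (real k) = real k" "sqrt (real k) > 0" by auto
      thus "1 / real k * (C * (sqrt (real k) / sqrt N)) = (C / sqrt N) * (1 / sqrt (real k))"
        using N by (simp add: field_simps)
    qed simp
    also have "\<dots> = (C / sqrt N) * (\<Sum>k=1..n. 1 / sqrt (real k))" by (simp only: sum_distrib_left)
    also have "\<dots> \<le> (C / sqrt N) * (2 * sqrt (real n))"
      using C0 N by (intro mult_left_mono sum_inverse_sqrt_le) auto
    also have "\<dots> \<le> (C / sqrt N) * (2 * sqrt N)"
      using C0 N by (intro mult_left_mono) (auto simp: N_def)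
    also have "\<dots> = 2 * C" using N by simp
    finally show "2 / N * expectation (\<lambda>\<omega>. D \<omega> * g (Suc n) \<omega>) \<le> 2 / N * (2 * C)"
      using N by (intro mult_left_mono) auto
    have "expectation (\<lambda>\<omega>. (g (Suc n) \<omega>)\<^sup>2) \<le> C" 
      using gg[of "Suc n" "Suc n"] by (simp add: power2_eq_square del: of_nat_Suc)
    hence "1 / N\<^sup>2 * expectation (\<lambda>\<omega>. (g (Suc n) \<omega>)\<^sup>2) \<le> 1 / N\<^sup>2 * C" by (intro mult_left_mono) auto
    also have "\<dots> \<le> 1 / N * C" 
      using C0 N1 by (intro mult_right_mono) (auto simp: power2_eq_square field_simps)
    finally show "1 / N\<^sup>2 * expectation (\<lambda>\<omega>. (g (Suc n) \<omega>)\<^sup>2) \<le> 1 / N * C" .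
  qed
  also have "\<dots> = 5 * C * harm (Suc n)" by (simp add: harm_Suc N_def[symmetric] field_simps del: of_nat_Suc)
  finally show ?case unfolding g_def C_def by simp
qed

text \<open>At n = 2^(i^2) the second moment of the centred mean is of order harm n / (ln n)^2,
  hence O(1/i^2). The centring is undone by regularity of logarithmic means applied to the
  expectations.\<close>

lemma AE_log_mean_lipschitz:
  fixes f :: "real \<Rightarrow> real"
  assumes f: "\<And>x y. \<bar>f x - f y\<bar> \<le> a * \<bar>x - y\<bar>" and f1: "\<And>x. \<bar>f x\<bar> \<le> 1"
    and lim: "(\<lambda>n. expectation (\<lambda>\<omega>. f (T n \<omega>))) \<longlonglongrightarrow> l"
  shows "AE \<omega> in M. log_mean (\<lambda>k. f (T k \<omega>)) \<longlonglongrightarrow> l"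
proof -
  note lipschitz_borel_measurable[OF f, measurable]
  define g where "g k \<omega> = f (T k \<omega>) - expectation (\<lambda>\<omega>. f (T k \<omega>))" for k \<omega>
  have [measurable]: "random_variable borel (g k)" for k unfolding g_def by measurable
  have fi [simp]: "integrable M (\<lambda>\<omega>. f (T k \<omega>))" for k
    by (auto intro!: integrable_const_bound[where B=1] AE_I2 f1)
  have Ef: "\<bar>expectation (\<lambda>\<omega>. f (T k \<omega>))\<bar> \<le> 1" for k
    using order_trans[OF integral_abs_bound integral_mono[of M "\<lambda>\<omega>. \<bar>f (T k \<omega>)\<bar>" "\<lambda>_. 1"]] f1
    by (simp add: prob_space)
  have gb: "\<bar>g k \<omega>\<bar> \<le> 2" for k \<omega> using Ef[of k] f1[of "T k \<omega>"] unfolding g_def by linarith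
  have g4: "(g k \<omega>)\<^sup>2 \<le> 4" for k \<omega>
    using power_mono[OF gb[of k \<omega>], of 2] by simp
  define Z where "Z i \<omega> = log_mean (\<lambda>k. g k \<omega>) (2 ^ (i\<^sup>2))" for i \<omega>
  have Zm: "random_variable borel (Z i)" for i unfolding Z_def log_mean_def by measurable
  have Z2: "integrable M (\<lambda>\<omega>. (Z i \<omega>)\<^sup>2)" for i
    unfolding Z_def log_mean_def
    by (intro integrable_square_cmult integrable_square_sum)
      (auto intro!: integrable_const_bound[where B=4] AE_I2 g4)
  have bound: "expectation (\<lambda>\<omega>. (Z i \<omega>)\<^sup>2) \<le> 20 * a\<^sup>2 * \<Gamma> / (ln 2)\<^sup>2 * (1 / (real i)\<^sup>2)" if "i > 0" for i
  proof -
    define n :: nat where "n = 2 ^ (i\<^sup>2)"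
    have lnn: "ln (real n) = (real i)\<^sup>2 * ln 2" by (simp add: n_def ln_realpow)
    have i2: "(real i)\<^sup>2 \<ge> 1" using that by simp
    have l2: "0 < ln (2::real)" "ln (2::real) \<le> 1" using ln_2_less_1 by auto
    have h: "harm n \<le> 2 * (real i)\<^sup>2"
    proof -
      have "harm n \<le> 1 + (real i)\<^sup>2 * ln 2" using harm_le_one_plus_ln[of n] lnn by (simp add: n_def)
      also have "\<dots> \<le> (real i)\<^sup>2 + (real i)\<^sup>2 * 1" using i2 l2 by (intro add_mono mult_left_mono) auto
      finally show ?thesis by simp
    qed
    have "expectation (\<lambda>\<omega>. (Z i \<omega>)\<^sup>2) = 1 / (ln (real n))\<^sup>2 * expectation (\<lambda>\<omega>. (\<Sum>k=1..n. 1 / real k * g k \<omega>)\<^sup>2)"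
      unfolding Z_def log_mean_def n_def[symmetric] by (simp add: power_mult_distrib power_divide)
    also have "\<dots> \<le> 1 / (ln (real n))\<^sup>2 * (10 * a\<^sup>2 * \<Gamma> * harm n)"
      unfolding g_def by (intro mult_left_mono log_sum_second_moment[OF f f1]) auto
    also have "\<dots> \<le> 1 / (ln (real n))\<^sup>2 * (10 * a\<^sup>2 * \<Gamma> * (2 * (real i)\<^sup>2))"
      using \<Gamma>_nonneg by (intro mult_left_mono h) auto
    also have "\<dots> = 20 * a\<^sup>2 * \<Gamma> / (ln 2)\<^sup>2 * (1 / (real i)\<^sup>2)"
      unfolding lnn using that by (simp add: field_simps power2_eq_square)
    finally show ?thesis .
  qed
  have "summable (\<lambda>i. expectation (\<lambda>\<omega>. (Z i \<omega>)\<^sup>2))"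
  proof (rule summable_comparison_test_ev)
    show "\<forall>\<^sub>F i in sequentially. norm (expectation (\<lambda>\<omega>. (Z i \<omega>)\<^sup>2)) \<le> 20 * a\<^sup>2 * \<Gamma> / (ln 2)\<^sup>2 * (1 / (real i)\<^sup>2)"
      using eventually_gt_at_top[of 0] by eventually_elim (use bound in simp)
    show "summable (\<lambda>i. 20 * a\<^sup>2 * \<Gamma> / (ln 2)\<^sup>2 * (1 / (real i)\<^sup>2))"
      using inverse_power_summable[of 2, where 'a=real] by (intro summable_mult) (simp add: inverse_eq_divide)
  qed
  from AE_tendsto_0_of_summable_square[OF Zm Z2 this]
  show ?thesis
  proof eventually_elim
    case (elim \<omega>)
    have "log_mean (\<lambda>k. g k \<omega>) \<longlonglongrightarrow> 0"
      by (rule log_mean_tendsto_0_subsequence[OF gb]) (use elim in \<open>simp add: Z_def\<close>)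
    from tendsto_add[OF this log_mean_tendsto[OF lim]]
    show ?case by (simp add: g_def log_mean_diff)
  qed
qed

text \<open>An image of the standard normal law, so that zero variance is covered as well and gives
  the point mass at 0.\<close>

definition limit_law where "limit_law = distr std_normal_distribution borel (\<lambda>x. sqrt asym_var * x)"

lemma real_distribution_limit_law: "real_distribution limit_law"
proof -
  interpret N: real_distribution std_normal_distribution by (rule real_dist_normal_dist)
  show ?thesis unfolding limit_law_def by (rule N.real_distribution_distr) simp
qed

lemma weak_conv_T: "weak_conv_m (\<lambda>n. distr M borel (T n)) limit_law"
proof (rule levy_continuity)
  fix t
  have s: "asym_var \<ge> 0" using asym_var_ge \<gamma>_nonneg[of 0] by linarith
  have "char limit_law t = char std_normal_distribution (t * sqrt asym_var)"
    unfolding limit_law_def char_def by (subst integral_distr) (auto simp: mult_ac)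
  also have "\<dots> = complex_of_real (exp (- (t\<^sup>2 * asym_var / 2)))"
    using s by (simp add: char_std_normal_distribution power_mult_distrib)
  finally show "(\<lambda>n. char (distr M borel (T n)) t) \<longlonglongrightarrow> char limit_law t"
    using char_T_tendsto by simp
qed (auto intro: real_distribution_distr real_distribution_limit_law)

lemma isCont_cdf_limit_law:
  assumes "asym_var > 0"
  shows "isCont (cdf limit_law) t"
proof -
  interpret L: real_distribution limit_law by (rule real_distribution_limit_law)
  have "emeasure limit_law {t} = emeasure std_normal_distribution {t / sqrt asym_var}"
    unfolding limit_law_def using assms
    by (subst emeasure_distr) (auto intro!: arg_cong2[where f=emeasure] simp: field_simps)
  also have "\<dots> = 0"
    by (subst emeasure_density) (auto simp: nn_integral_cmult_indicator nn_integral_0_iff_AE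
        intro!: AE_mp[OF AE_lborel_singleton[of "t / sqrt asym_var"]])
  finally show ?thesis by (simp add: L.isCont_cdf measure_def)
qed

theorem AE_log_mean_T:
  "AE \<omega> in M. (\<lambda>n. \<bar>prob {\<omega>'\<in>space M. T n \<omega>' \<le> t} - log_mean (\<lambda>k. indicator {\<omega>'. T k \<omega>' \<le> t} \<omega>) n\<bar>) \<longlonglongrightarrow> 0"
proof (cases "asym_var > 0")
  case True
  interpret L: real_distribution limit_law by (rule real_distribution_limit_law)
  define F where "F = cdf limit_law"
  have cont: "isCont F t" unfolding F_def by (rule isCont_cdf_limit_law[OF True])
  have "(\<lambda>n. cdf (distr M borel (T n)) t) \<longlonglongrightarrow> F t"
    using weak_conv_T cont unfolding weak_conv_m_def weak_conv_def F_def by blast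
  moreover have "cdf (distr M borel (T n)) t = prob {\<omega>'\<in>space M. T n \<omega>' \<le> t}" for n
    by (auto simp: cdf_def measure_distr vimage_def intro!: arg_cong[where f=prob])
  ultimately have P: "(\<lambda>n. prob {\<omega>'\<in>space M. T n \<omega>' \<le> t}) \<longlonglongrightarrow> F t" by simp
  have step: "AE \<omega> in M. log_mean (\<lambda>k. cts_step a b (T k \<omega>)) \<longlonglongrightarrow> L.expectation (cts_step a b)" if "a < b" for a b
  proof (rule AE_log_mean_lipschitz[OF cts_step_lipschitz[OF that] cts_step_bounded[OF that]])
    have "continuous_on UNIV (cts_step a b)"
      by (rule uniformly_continuous_imp_continuous[OF cts_step_uniformly_continuous[OF that]])
    hence "isCont (cts_step a b) x" for x by (simp add: continuous_on_eq_continuous_at)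
    from weak_conv_imp_integral_bdd_continuous_conv[OF real_distribution_distr[OF rv_T] real_distribution_limit_law weak_conv_T this, of 1]
    have "(\<lambda>n. LINT x|distr M borel (T n). cts_step a b x) \<longlonglongrightarrow> L.expectation (cts_step a b)"
      using cts_step_bounded[OF that] by simp
    moreover have "(LINT x|distr M borel (T n). cts_step a b x) = expectation (\<lambda>\<omega>. cts_step a b (T n \<omega>))" for n
      by (rule integral_distr) (use lipschitz_borel_measurable[OF cts_step_lipschitz[OF that]] in auto)
    ultimately show "(\<lambda>n. expectation (\<lambda>\<omega>. cts_step a b (T n \<omega>))) \<longlonglongrightarrow> L.expectation (cts_step a b)" by simp
  qed
  \<comment> \<open>A countable family of widths, so that a single null set serves all of
    them.\<close>
  define h where "h p = 1 / real (Suc p)" for p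
  have h0: "h p > 0" for p by (simp add: h_def)
  have h_lim: "h \<longlonglongrightarrow> 0" unfolding h_def by (rule LIMSEQ_Suc[OF lim_1_over_n])
  have "AE \<omega> in M. \<forall>p. log_mean (\<lambda>k. cts_step t (t + h p) (T k \<omega>)) \<longlonglongrightarrow> L.expectation (cts_step t (t + h p))"
    "AE \<omega> in M. \<forall>p. log_mean (\<lambda>k. cts_step (t - h p) t (T k \<omega>)) \<longlonglongrightarrow> L.expectation (cts_step (t - h p) t)"
    using h0 by (auto simp: AE_all_countable intro!: step)
  thus ?thesis
  proof eventually_elim
    case (elim \<omega>)
    let ?I = "\<lambda>k. indicator {\<omega>'. T k \<omega>' \<le> t} \<omega> :: real"
    have "log_mean ?I \<longlonglongrightarrow> F t"
    proof (rule order_tendstoI)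
      fix y assume y: "y < F t"
      \<comment> \<open>Continuity of the limiting distribution function at t is used here: the
        lower step function has limit at least F (t - h p), which exceeds y for a suitable
        p.\<close>
      have "(\<lambda>p. F (t - h p)) \<longlonglongrightarrow> F t"
        by (rule isCont_tendsto_compose[OF cont]) (use tendsto_diff[OF tendsto_const h_lim, of t] in simp)
      from order_tendstoD(1)[OF this y] obtain p where p: "y < F (t - h p)"
        by (auto dest: eventually_happens)
      have "y < L.expectation (cts_step (t - h p) t)"
        using p L.cdf_cts_step(1)[of "t - h p" t] h0[of p] by (simp add: F_def)
      moreover have le: "log_mean (\<lambda>k. cts_step (t - h p) t (T k \<omega>)) n \<le> log_mean ?I n" for n
        using h0[of p] by (intro log_mean_mono) (auto simp: cts_step_def)
      ultimately show "\<forall>\<^sub>F n in sequentially. y < log_mean ?I n"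
        using order_tendstoD(1)[OF elim(2)[rule_format, of p], of y]
        by (auto elim!: eventually_mono intro: less_le_trans[OF _ le])
    next
      fix y assume y: "F t < y"
      have "(\<lambda>p. F (t + h p)) \<longlonglongrightarrow> F t"
        by (rule isCont_tendsto_compose[OF cont]) (use tendsto_add[OF tendsto_const h_lim, of t] in simp)
      from order_tendstoD(2)[OF this y] obtain p where p: "F (t + h p) < y"
        by (auto dest: eventually_happens)
      have "L.expectation (cts_step t (t + h p)) < y"
        using p L.cdf_cts_step(2)[of t "t + h p"] h0[of p] by (simp add: F_def)
      moreover have le: "log_mean ?I n \<le> log_mean (\<lambda>k. cts_step t (t + h p) (T k \<omega>)) n" for n
        using h0[of p] by (intro log_mean_mono) (auto simp: cts_step_def)
      ultimately show "\<forall>\<^sub>F n in sequentially. log_mean ?I n < y"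
        using order_tendstoD(2)[OF elim(1)[rule_format, of p], of y]
        by (auto elim!: eventually_mono intro: le_less_trans[OF le])
    qed
    from tendsto_diff[OF P this] show ?case by (simp add: tendsto_rabs_zero_iff)
  qed
next
  case False
  \<comment> \<open>The limiting variance dominates the variance of a single term, so when it is not
    positive every Y k vanishes almost surely.\<close>
  hence g0: "\<gamma> 0 = 0" using asym_var_ge \<gamma>_nonneg[of 0] by linarith
  have "AE \<omega> in M. Y k \<omega> = 0" for k
  proof -
    have "expectation (\<lambda>\<omega>. (Y k \<omega>)\<^sup>2) = 0" using cov_Y_shift[of k 0] g0 by (simp add: power2_eq_square)
    thus ?thesis using integral_nonneg_eq_0_iff_AE[OF sq[of k]] by simp
  qed
  hence "AE \<omega> in M. \<forall>k. Y k \<omega> = 0" by (simp add: AE_all_countable)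
  hence T0: "AE \<omega> in M. \<forall>n. T n \<omega> = 0" by eventually_elim (simp add: T_def S_def)
  define c :: real where "c = (if 0 \<le> t then 1 else 0)"
  have P: "prob {\<omega>'\<in>space M. T n \<omega>' \<le> t} = c" for n
  proof -
    have "prob {\<omega>'\<in>space M. T n \<omega>' \<le> t} = prob {\<omega>'\<in>space M. 0 \<le> t}"
      by (rule measure_eq_AE) (use T0 in auto)
    thus ?thesis by (simp add: c_def prob_space)
  qed
  from T0 show ?thesis
  proof eventually_elim
    case (elim \<omega>)
    have "(\<lambda>k. indicator {\<omega>'. T k \<omega>' \<le> t} \<omega>) = (\<lambda>k. c)" using elim by (auto simp: c_def)
    hence "log_mean (\<lambda>k. indicator {\<omega>'. T k \<omega>' \<le> t} \<omega>) \<longlonglongrightarrow> c" using log_mean_tendsto[of "\<lambda>_. c" c] by simp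
    from tendsto_diff[OF tendsto_const[of c] this] show ?case by (simp add: P tendsto_rabs_zero_iff)
  qed
qed

end

section \<open>Association\<close>

text \<open>The product of increments is integrated in x and then in y over the same space, in place
  of an independent copy on a product space. The two diagonal terms and the two mixed terms
  coincide, giving twice the claim.\<close>

lemma (in prob_space) chebyshev_expectation:
  fixes f g :: "'a \<Rightarrow> real"
  assumes [measurable]: "random_variable borel f" "random_variable borel g"
    and bd: "\<And>x. \<bar>f x\<bar> \<le> B" "\<And>x. \<bar>g x\<bar> \<le> B"
    and sim: "\<And>x y. x \<in> space M \<Longrightarrow> y \<in> space M \<Longrightarrow> 0 \<le> (f x - f y) * (g x - g y)"
  shows "expectation f * expectation g \<le> expectation (\<lambda>x. f x * g x)"
proof -
  have [simp]: "integrable M f" "integrable M g"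
    using bd by (auto intro!: integrable_const_bound[where B=B])
  have [simp]: "integrable M (\<lambda>x. f x * g x)"
    using bd order_trans[OF abs_ge_zero bd(1)]
    by (auto intro!: integrable_const_bound[where B="B*B"] AE_I2 mult_mono simp: abs_mult)
  define P where "P = expectation (\<lambda>x. f x * g x)"
  have 1: "0 \<le> P - f y * expectation g - g y * expectation f + f y * g y" if "y \<in> space M" for y
  proof -
    have "0 \<le> expectation (\<lambda>x. (f x - f y) * (g x - g y))"
      using that by (intro integral_nonneg_AE AE_I2 sim) auto
    also have "(\<lambda>x. (f x - f y) * (g x - g y)) = (\<lambda>x. f x * g x - f y * g x - g y * f x + f y * g y)"
      by (auto simp: algebra_simps)
    finally show ?thesis by (simp add: prob_space P_def)
  qed
  have "0 \<le> expectation (\<lambda>y. P - f y * expectation g - g y * expectation f + f y * g y)"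
    by (intro integral_nonneg_AE AE_I2 1) auto
  also have "\<dots> = 2 * P - 2 * (expectation f * expectation g)"
    by (simp add: prob_space P_def)
  finally show ?thesis by (simp add: P_def)
qed

context prob_space
begin

text \<open>Association in the sense of Esary, Proschan and Walkup; on products the order is
  componentwise. Measurability of the test functions is demanded separately because a monotone
  function of several variables need not be Borel.\<close>

definition associated :: "('a \<Rightarrow> 'b::{topological_space, order}) \<Rightarrow> bool" where
  "associated V \<longleftrightarrow> (\<forall>f g :: 'b \<Rightarrow> real. f \<in> borel_measurable borel \<longrightarrow> g \<in> borel_measurable borel \<longrightarrow>
     mono f \<longrightarrow> mono g \<longrightarrow> bounded (range f) \<longrightarrow> bounded (range g) \<longrightarrow>
     expectation (\<lambda>x. f (V x)) * expectation (\<lambda>x. g (V x)) \<le> expectation (\<lambda>x. f (V x) * g (V x)))"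

text \<open>On a total order the increments of two monotone functions never have opposite signs.
  This fails on products, where independence has to come in.\<close>

lemma associated_real:
  fixes U :: "'a \<Rightarrow> real"
  assumes [measurable]: "random_variable borel U"
  shows "associated U"
  unfolding associated_def
proof safe
  fix f g :: "real \<Rightarrow> real"
  assume [measurable]: "f \<in> borel_measurable borel" "g \<in> borel_measurable borel"
    and m: "mono f" "mono g" and b: "bounded (range f)" "bounded (range g)"
  obtain B1 B2 where B: "\<And>x. \<bar>f x\<bar> \<le> B1" "\<And>x. \<bar>g x\<bar> \<le> B2"
    using b unfolding bounded_iff by auto
  show "expectation (\<lambda>x. f (U x)) * expectation (\<lambda>x. g (U x)) \<le> expectation (\<lambda>x. f (U x) * g (U x))"
  proof (rule chebyshev_expectation[where B="max B1 B2"])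
    fix x y
    show "0 \<le> (f (U x) - f (U y)) * (g (U x) - g (U y))"
      using monoD[OF m(1), of "U x" "U y"] monoD[OF m(2), of "U x" "U y"]
        monoD[OF m(1), of "U y" "U x"] monoD[OF m(2), of "U y" "U x"]
      by (cases "U x \<le> U y") (auto intro: mult_nonpos_nonpos)
  qed (use B in \<open>auto simp: le_max_iff_disj\<close>)
qed

lemma associated_mono:
  fixes V :: "'a \<Rightarrow> 'b::{topological_space, order}" and h :: "'b \<Rightarrow> 'c::{topological_space, order}"
  assumes V: "associated V" and [measurable]: "h \<in> borel_measurable borel" and h: "mono h"
    and V': "\<And>x. x \<in> space M \<Longrightarrow> V' x = h (V x)"
  shows "associated V'"
  unfolding associated_def
proof safe
  fix f g :: "'c \<Rightarrow> real"
  assume [measurable]: "f \<in> borel_measurable borel" "g \<in> borel_measurable borel"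
    and m: "mono f" "mono g" and b: "bounded (range f)" "bounded (range g)"
  have "mono (\<lambda>x. f (h x))" "mono (\<lambda>x. g (h x))" using m h by (auto simp: mono_def)
  moreover have "bounded (range (\<lambda>x. f (h x)))" "bounded (range (\<lambda>x. g (h x)))"
    using b by (auto intro: bounded_subset)
  moreover have "(\<lambda>x. f (h x)) \<in> borel_measurable borel" "(\<lambda>x. g (h x)) \<in> borel_measurable borel"
    by measurable
  ultimately have "expectation (\<lambda>x. f (h (V x))) * expectation (\<lambda>x. g (h (V x))) \<le> expectation (\<lambda>x. f (h (V x)) * g (h (V x)))"
    using V unfolding associated_def by blast
  thus "expectation (\<lambda>x. f (V' x)) * expectation (\<lambda>x. g (V' x)) \<le> expectation (\<lambda>x. f (V' x) * g (V' x))"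
    using V' by (simp cong: Bochner_Integration.integral_cong)
qed

text \<open>For a fixed value of V only the real variable U is left, and Chebyshev's inequality
  applies. Integrating U out gives functions F and G of V that are still monotone, so association of
  V finishes the estimate.\<close>

lemma associated_Pair:
  fixes V :: "'a \<Rightarrow> 'b::{second_countable_topology, order}" and U :: "'a \<Rightarrow> real"
  assumes V: "associated V" and [measurable]: "random_variable borel V" "random_variable borel U"
    and ind: "distr M borel (\<lambda>x. (V x, U x)) = distr M borel V \<Otimes>\<^sub>M distr M borel U"
  shows "associated (\<lambda>x. (V x, U x))"
  unfolding associated_def
proof safe
  fix f g :: "'b \<times> real \<Rightarrow> real"
  assume fg [measurable]: "f \<in> borel_measurable borel" "g \<in> borel_measurable borel"
    and m: "mono f" "mono g" and b: "bounded (range f)" "bounded (range g)"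
  obtain B1 B2 where "\<And>x. \<bar>f x\<bar> \<le> B1" "\<And>x. \<bar>g x\<bar> \<le> B2"
    using b unfolding bounded_iff by auto
  define B where "B = max B1 B2"
  have B: "\<bar>f x\<bar> \<le> B" "\<bar>g x\<bar> \<le> B" for x
    using \<open>\<And>x. \<bar>f x\<bar> \<le> B1\<close>[of x] \<open>\<And>x. \<bar>g x\<bar> \<le> B2\<close>[of x] by (auto simp: B_def)
  have B0: "0 \<le> B" using B(1)[of undefined] by linarith
  define D E where "D = distr M borel V" and "E = distr M borel U"
  interpret D: prob_space D unfolding D_def by (rule prob_space_distr) simp
  interpret E: prob_space E unfolding E_def by (rule prob_space_distr) simp
  interpret DE: pair_prob_space D E ..
  have sets: "sets (D \<Otimes>\<^sub>M E) = sets borel" 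
    unfolding borel_prod[symmetric] by (intro sets_pair_measure_cong) (auto simp: D_def E_def)
  have [measurable]: "f \<in> borel_measurable (D \<Otimes>\<^sub>M E)" "g \<in> borel_measurable (D \<Otimes>\<^sub>M E)"
    using fg by (auto simp: measurable_cong_sets[OF sets refl])
  have sp [simp]: "space D = UNIV" "space E = UNIV" "sets D = sets borel" "sets E = sets borel" 
    by (auto simp: D_def E_def)
  have joint: "distr M borel (\<lambda>x. (V x, U x)) = D \<Otimes>\<^sub>M E"
    using ind unfolding D_def E_def .
  have fubini: "expectation (\<lambda>x. k (V x, U x)) = (LINT v|D. (LINT u|E. k (v, u)))"
    if [measurable]: "k \<in> borel_measurable (D \<Otimes>\<^sub>M E)" and k: "\<And>x. \<bar>k x\<bar> \<le> C" for k :: "'b \<times> real \<Rightarrow> real" and C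
  proof -
    have [measurable]: "k \<in> borel_measurable borel" using that by (simp add: measurable_cong_sets[OF sets refl])
    have "expectation (\<lambda>x. k (V x, U x)) = (LINT p|distr M borel (\<lambda>x. (V x, U x)). k p)"
      by (subst integral_distr) auto
    also have "\<dots> = (LINT v|D. (LINT u|E. k (v, u)))"
      unfolding joint by (rule DE.integral_fst'[symmetric]) (rule DE.integrable_const_bound[where B=C], use k in auto)
    finally show ?thesis .
  qed
  define F G where "F v = (LINT u|E. f (v, u))" and "G v = (LINT u|E. g (v, u))" for v
  have int: "integrable E (\<lambda>u. f (v, u))" "integrable E (\<lambda>u. g (v, u))" for v
    using B by (auto intro!: E.integrable_const_bound[where B=B])
  have Fm: "F \<in> borel_measurable borel" "G \<in> borel_measurable borel"
    using sp(3) unfolding F_def G_def by (auto simp: measurable_cong_sets[OF sp(3)[symmetric] refl])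
  have Fb: "\<bar>F v\<bar> \<le> B" "\<bar>G v\<bar> \<le> B" for v
    using order_trans[OF integral_abs_bound integral_mono[of E "\<lambda>u. \<bar>f (v, u)\<bar>" "\<lambda>_. B"]]
      order_trans[OF integral_abs_bound integral_mono[of E "\<lambda>u. \<bar>g (v, u)\<bar>" "\<lambda>_. B"]] int B
    by (auto simp: F_def G_def E.prob_space[simplified])
  have Fmono: "mono F" "mono G"
    using int m by (auto simp: F_def G_def mono_def intro!: integral_mono)
  have "expectation (\<lambda>x. f (V x, U x)) * expectation (\<lambda>x. g (V x, U x)) = D.expectation F * D.expectation G"
    using fubini[of f B] fubini[of g B] B by (simp add: F_def[abs_def] G_def[abs_def])
  also have "\<dots> = expectation (\<lambda>x. F (V x)) * expectation (\<lambda>x. G (V x))"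
    unfolding D_def using Fm by (simp add: integral_distr)
  also have "\<dots> \<le> expectation (\<lambda>x. F (V x) * G (V x))"
    using V Fm Fmono Fb unfolding associated_def by (auto simp: bounded_iff)
  also have "\<dots> = D.expectation (\<lambda>v. F v * G v)"
    unfolding D_def using Fm by (simp add: integral_distr)
  also have "\<dots> \<le> D.expectation (\<lambda>v. LINT u|E. f (v, u) * g (v, u))"
  proof (rule integral_mono)
    show "integrable D (\<lambda>v. F v * G v)"
      using Fm Fb B0 by (auto intro!: D.integrable_const_bound[where B="B*B"] AE_I2 mult_mono
          simp: abs_mult measurable_cong_sets[OF sp(3) refl])
    show "integrable D (\<lambda>v. LINT u|E. f (v, u) * g (v, u))"
      by (rule DE.integrable_fst', rule DE.integrable_const_bound[where B="B*B"])
        (use B B0 in \<open>auto intro!: AE_I2 mult_mono simp: abs_mult\<close>)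
    fix v
    show "F v * G v \<le> (LINT u|E. f (v, u) * g (v, u))"
      unfolding F_def G_def
    proof (rule E.chebyshev_expectation[where B=B])
      fix x y :: real
      show "0 \<le> (f (v, x) - f (v, y)) * (g (v, x) - g (v, y))"
        using monoD[OF m(1), of "(v, x)" "(v, y)"] monoD[OF m(2), of "(v, x)" "(v, y)"]
          monoD[OF m(1), of "(v, y)" "(v, x)"] monoD[OF m(2), of "(v, y)" "(v, x)"]
        by (cases "x \<le> y") (auto intro: mult_nonpos_nonpos)
    qed (use B in auto)
  qed
  also have "\<dots> = expectation (\<lambda>x. f (V x, U x) * g (V x, U x))"
    by (rule fubini[of "\<lambda>p. f p * g p" "B * B", symmetric]) (use B B0 in \<open>auto intro!: mult_mono simp: abs_mult\<close>)
  finally show "expectation (\<lambda>x. f (V x, U x)) * expectation (\<lambda>x. g (V x, U x))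
    \<le> expectation (\<lambda>x. f (V x, U x) * g (V x, U x))" .
qed

text \<open>The past up to m and the innovation at n are generated by disjoint groups of an
  independent family. The conclusion is a product law because that is what Fubini in the association
  step consumes.\<close>

lemma distr_Pair_past_sigma:
  fixes \<xi> :: "int \<Rightarrow> 'a \<Rightarrow> real" and V :: "'a \<Rightarrow> 'b::second_countable_topology" and u :: "real \<Rightarrow> real"
  assumes ind: "indep_vars (\<lambda>_. borel) \<xi> UNIV"
    and V: "V \<in> borel_measurable (past_sigma M \<xi> m)" and mn: "m < n"
    and [measurable]: "u \<in> borel_measurable borel"
  shows "random_variable borel V"
    and "distr M borel (\<lambda>x. (V x, u (\<xi> n x))) = distr M borel V \<Otimes>\<^sub>M distr M borel (\<lambda>x. u (\<xi> n x))"
proof -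
  define G where "G k = {\<xi> k -` A \<inter> space M | A. A \<in> sets borel}" for k
  \<comment> \<open>Two groups indexed by a Boolean: the past for True, the single index n for
    False.\<close>
  define I where "I b = (if b then {..m} else {n})" for b
  have rv [measurable]: "random_variable borel (\<xi> k)" for k using ind by (auto simp: indep_vars_def2)
  have "indep_sets G UNIV" using ind by (auto simp: indep_vars_def2 G_def[abs_def])
  hence "indep_sets G (\<Union>b\<in>UNIV. I b)" by (rule indep_sets_mono_index[rotated]) auto
  moreover have "Int_stable (G k)" for k
    unfolding G_def Int_stable_def
  proof safe
    fix A B :: "real set" assume "A \<in> sets borel" "B \<in> sets borel"
    thus "\<exists>C. \<xi> k -` A \<inter> space M \<inter> (\<xi> k -` B \<inter> space M) = \<xi> k -` C \<inter> space M \<and> C \<in> sets borel"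
      by (intro exI[of _ "A \<inter> B"]) auto
  qed
  moreover have "disjoint_family_on I UNIV" using mn by (auto simp: disjoint_family_on_def I_def)
  ultimately have J: "indep_sets (\<lambda>b. sigma_sets (space M) (\<Union>k\<in>I b. G k)) UNIV"
    by (rule indep_sets_collect_sigma)
  have gen: "{\<xi> k -` B \<inter> space M |k B. k \<le> m \<and> B \<in> sets borel} = (\<Union>k\<in>I True. G k)"
    by (auto simp: I_def G_def)
  have sp: "sets (past_sigma M \<xi> m) = sigma_sets (space M) (\<Union>k\<in>I True. G k)"
    unfolding past_sigma_def gen by (rule sets_measure_of) (auto simp: G_def)
  have space: "space (past_sigma M \<xi> m) = space M"
    unfolding past_sigma_def gen by (rule space_measure_of) (auto simp: G_def)
  have sub: "sigma_sets (space M) (\<Union>k\<in>I True. G k) \<subseteq> events"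
    by (rule sets.sigma_sets_subset) (auto simp: G_def)
  show rvV [measurable]: "random_variable borel V"
    using V sub by (auto simp: measurable_def sp space)
  have pre: "V -` A \<inter> space M \<in> sigma_sets (space M) (\<Union>k\<in>I True. G k)" if "A \<in> sets borel" for A
    using measurable_sets[OF V that] by (simp add: sp space)
  have prod: "prob ((V -` A \<inter> space M) \<inter> (\<xi> n -` C \<inter> space M)) = prob (V -` A \<inter> space M) * prob (\<xi> n -` C \<inter> space M)"
    if "A \<in> sets borel" "C \<in> sets borel" for A and C
  proof -
    have "\<xi> n -` C \<inter> space M \<in> sigma_sets (space M) (\<Union>k\<in>I False. G k)"
      using that by (intro sigma_sets.Basic) (auto simp: I_def G_def)
    with indep_setsD[OF J, of UNIV "\<lambda>b. if b then V -` A \<inter> space M else \<xi> n -` C \<inter> space M"] pre[OF that(1)]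
    show ?thesis by (simp add: UNIV_bool Int_commute mult.commute)
  qed
  define D E where "D = distr M borel V" and "E = distr M borel (\<lambda>x. u (\<xi> n x))"
  interpret D: prob_space D unfolding D_def by (rule prob_space_distr) simp
  interpret E: prob_space E unfolding E_def by (rule prob_space_distr) simp
  have "D \<Otimes>\<^sub>M E = distr M borel (\<lambda>x. (V x, u (\<xi> n x)))"
  proof (rule pair_measure_eqI)
    show "sets (D \<Otimes>\<^sub>M E) = sets (distr M borel (\<lambda>x. (V x, u (\<xi> n x))))"
      unfolding sets_distr borel_prod[symmetric] by (intro sets_pair_measure_cong) (auto simp: D_def E_def)
    fix A B assume "A \<in> sets D" "B \<in> sets E"
    hence AB [measurable]: "A \<in> sets borel" "B \<in> sets borel" by (auto simp: D_def E_def)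
    have uB: "u -` B \<in> sets borel" using measurable_sets[OF assms(4) AB(2)] by simp
    have "A \<times> B \<in> sets borel" unfolding borel_prod[symmetric] using AB by auto
    hence "emeasure (distr M borel (\<lambda>x. (V x, u (\<xi> n x)))) (A \<times> B)
      = emeasure M ((V -` A \<inter> space M) \<inter> (\<xi> n -` (u -` B) \<inter> space M))"
      by (subst emeasure_distr) (auto intro!: arg_cong[where f="emeasure M"])
    also have "\<dots> = emeasure M (V -` A \<inter> space M) * emeasure M (\<xi> n -` (u -` B) \<inter> space M)"
      using prod[OF AB(1) uB] by (simp add: emeasure_eq_measure ennreal_mult)
    also have "\<dots> = emeasure D A * emeasure E B"
      using AB unfolding D_def E_def by (simp add: emeasure_distr vimage_comp comp_def)
    finally show "emeasure D A * emeasure E B = emeasure (distr M borel (\<lambda>x. (V x, u (\<xi> n x)))) (A \<times> B)" ..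
  qed (unfold_locales)
  thus "distr M borel (\<lambda>x. (V x, u (\<xi> n x))) = distr M borel V \<Otimes>\<^sub>M distr M borel (\<lambda>x. u (\<xi> n x))"
    by (simp add: D_def E_def)
qed

end

section \<open>Squares of augmented GARCH processes\<close>

locale garch = prob_space +
  fixes X \<xi> \<sigma> :: "int \<Rightarrow> 'a \<Rightarrow> real" and \<phi> :: "real \<times> real \<Rightarrow> real" and \<Lambda> :: "real \<Rightarrow> real"
  assumes garch: "aug_garch X \<xi> \<sigma> \<phi> \<Lambda>"
begin

section \<open>Consequences of the defining relations\<close>

lemma indep_\<xi>: "indep_vars (\<lambda>_. borel) \<xi> UNIV"
  and distr_\<xi>: "distr M borel (\<xi> k) = distr M borel (\<xi> 0)"
  and \<sigma>_pos: "\<omega> \<in> space M \<Longrightarrow> \<sigma> n \<omega> > 0"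
  and stationary_\<sigma>: "stationary_process \<sigma>"
  and past_\<sigma>: "\<sigma> n \<in> borel_measurable (past_sigma M \<xi> (n - 1))"
  and meas_\<phi> [measurable]: "\<phi> \<in> borel_measurable borel"
  and mono_\<phi>: "a \<le> a' \<Longrightarrow> b \<le> b' \<Longrightarrow> \<phi> (a, b) \<le> \<phi> (a', b')"
  and meas_\<Lambda>: "\<Lambda> \<in> borel_measurable (restrict_space borel {0..})"
  and mono_\<Lambda>: "strict_mono_on {0..} \<Lambda>"
  and X_eq: "\<omega> \<in> space M \<Longrightarrow> X n \<omega> = \<sigma> n \<omega> * \<xi> n \<omega>"
  and recursion: "\<omega> \<in> space M \<Longrightarrow> \<Lambda> ((\<sigma> n \<omega>)\<^sup>2) = \<phi> (\<Lambda> ((\<sigma> (n - 1) \<omega>)\<^sup>2), (\<xi> (n - 1) \<omega>)\<^sup>2)"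
  using garch unfolding aug_garch_def by blast+

lemma rv_\<xi> [measurable]: "random_variable borel (\<xi> k)"
  using indep_\<xi> by (auto simp: indep_vars_def2)

lemma rv_\<sigma> [measurable]: "random_variable borel (\<sigma> k)"
  using stationary_\<sigma> by (auto simp: stationary_process_def)

lemma rv_X [measurable]: "random_variable borel (X k)"
  by (subst measurable_cong[OF X_eq]) measurable

lemma distr_\<sigma>: "distr M borel (\<sigma> k) = distr M borel (\<sigma> 0)"
proof -
  have "distr (distr M (PiM UNIV (\<lambda>_. borel)) (\<lambda>\<omega> j. \<sigma> (j + k) \<omega>)) borel (\<lambda>x. x 0)
    = distr (distr M (PiM UNIV (\<lambda>_. borel)) (\<lambda>\<omega> j. \<sigma> j \<omega>)) borel (\<lambda>x. x 0)"
    using stationary_\<sigma> by (simp add: stationary_process_def)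
  thus ?thesis by (subst (asm) (1 2) distr_distr) (auto simp: comp_def intro!: measurable_PiM_single')
qed

definition W where "W n \<omega> = \<Lambda> ((\<sigma> n \<omega>)\<^sup>2)"

text \<open>Measurability of \<open>\<Lambda>\<close> is given on the half-line only, which squares
  never leave.\<close>

lemma meas_\<Lambda>_square [measurable]: "(\<lambda>x. \<Lambda> (x\<^sup>2)) \<in> borel_measurable borel"
  by (rule measurable_compose[OF measurable_restrict_space2 meas_\<Lambda>]) auto

lemma rv_W [measurable]: "random_variable borel (W n)"
  unfolding W_def by (rule measurable_compose[OF rv_\<sigma> meas_\<Lambda>_square])

lemma past_W: "W n \<in> borel_measurable (past_sigma M \<xi> (n - 1))"
  unfolding W_def by (rule measurable_compose[OF past_\<sigma> meas_\<Lambda>_square])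

lemma W_Suc: "\<omega> \<in> space M \<Longrightarrow> W (n + 1) \<omega> = \<phi> (W n \<omega>, (\<xi> n \<omega>)\<^sup>2)"
  using recursion[of \<omega> "n + 1"] by (simp add: W_def)

text \<open>Generalised inverse capped at K. The inserted 0 keeps the set nonempty below the range
  of \<open>\<Lambda>\<close>, the cap keeps it bounded above the range; the result is finite,
  nonnegative and monotone on the whole line.\<close>

definition inv_trunc where "inv_trunc K y = Sup (insert 0 {x. 0 \<le> x \<and> x \<le> real K \<and> \<Lambda> x \<le> y})" for K :: nat
text \<open>Above the range of a bounded \<open>\<Lambda>\<close> the truncations diverge and
  \<open>lim\<close> is an unspecified value. The function is used through its measurability, in
  identities between laws.\<close>

definition inv_\<Lambda> where "inv_\<Lambda> y = lim (\<lambda>K. inv_trunc K y)"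

lemma bdd_inv_trunc: "bdd_above (insert 0 {x. 0 \<le> x \<and> x \<le> real K \<and> \<Lambda> x \<le> y})"
  by (rule bdd_aboveI[of _ "real K"]) auto

lemma mono_inv_trunc: "mono (inv_trunc K)"
  unfolding inv_trunc_def by (intro monoI cSup_subset_mono bdd_inv_trunc) auto

lemma inv_trunc_nonneg: "0 \<le> inv_trunc K y"
  unfolding inv_trunc_def by (rule cSup_upper[OF _ bdd_inv_trunc]) simp

lemma inv_trunc_\<Lambda>:
  assumes "0 \<le> x"
  shows "inv_trunc K (\<Lambda> x) = min x (real K)"
proof -
  have "\<Lambda> z \<le> \<Lambda> x \<longleftrightarrow> z \<le> x" if "0 \<le> z" for z
    using strict_mono_on_leD[OF mono_\<Lambda>] strict_mono_onD[OF mono_\<Lambda>] that assms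
    by (metis atLeast_iff linorder_not_le)
  hence "insert 0 {z. 0 \<le> z \<and> z \<le> real K \<and> \<Lambda> z \<le> \<Lambda> x} = {0..min x (real K)}"
    using assms by auto
  thus ?thesis unfolding inv_trunc_def using assms by simp
qed

lemma meas_inv_trunc [measurable]: "inv_trunc K \<in> borel_measurable borel"
  by (rule borel_measurable_mono[OF mono_inv_trunc])

lemma meas_inv_\<Lambda> [measurable]: "inv_\<Lambda> \<in> borel_measurable borel"
  unfolding inv_\<Lambda>_def by (rule borel_measurable_lim_metric) simp

lemma eventually_min_eq: "\<forall>\<^sub>F K in sequentially. min x (real K) = x"
proof -
  obtain N where N: "x \<le> real N" using real_arch_simple by blast
  show ?thesis using eventually_ge_at_top[of N]
  proof eventually_elim
    case (elim K)
    hence "x \<le> real K" using N by simp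
    thus ?case by simp
  qed
qed

lemma inv_\<Lambda>_\<Lambda>: "0 \<le> x \<Longrightarrow> inv_\<Lambda> (\<Lambda> x) = x"
  unfolding inv_\<Lambda>_def by (simp add: inv_trunc_\<Lambda>) (rule limI, rule tendsto_eventually, rule eventually_min_eq)

text \<open>The partial sums are taken with a general transform \<open>h\<close> of \<open>W\<close>: the inverse of \<open>\<Lambda>\<close> gives the
  squares of the process, a truncated inverse keeps the state monotone in the innovations.\<close>

definition psum where
  "psum h c a n \<omega> = (\<Sum>k<n. c k * (h (W (a + int k) \<omega>) * (\<xi> (a + int k) \<omega>)\<^sup>2))" for c :: "nat \<Rightarrow> real"

text \<open>Two sums are carried so that, with indicator weights, sums over two index sets are two
  coordinates. W runs one index ahead of the sums, so the next state depends only on this one and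
  the innovation at a + n.\<close>

definition state where "state h c d a n \<omega> = (psum h c a n \<omega>, psum h d a n \<omega>, W (a + int n) \<omega>)"

text \<open>The innovation enters as \<open>max e 0\<close> so that \<open>step\<close> is monotone on all of its domain.\<close>

definition step where
  "step h c d n = (\<lambda>((x, y, w), e). (x + c n * (h w * max e 0), y + d n * (h w * max e 0), \<phi> (w, max e 0)))"
  for c d :: "nat \<Rightarrow> real"

lemma state_Suc:
  assumes "\<omega> \<in> space M"
  shows "state h c d a (Suc n) \<omega> = step h c d n (state h c d a n \<omega>, (\<xi> (a + int n) \<omega>)\<^sup>2)"
  using W_Suc[OF assms, of "a + int n"] by (simp add: state_def step_def psum_def add_ac)

lemma meas_step:
  assumes [measurable]: "h \<in> borel_measurable borel"
  shows "step h c d n \<in> borel_measurable borel"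
proof -
  have [measurable]: "\<phi> \<in> borel_measurable (borel \<Otimes>\<^sub>M borel)" by (simp add: borel_prod)
  show ?thesis unfolding step_def borel_prod[symmetric] split_beta' by measurable
qed

text \<open>The sums stop before a + n, and W at a + n is a function of earlier innovations; hence
  the innovation at a + n is independent of the state.\<close>

lemma past_state:
  assumes [measurable]: "h \<in> borel_measurable borel"
  shows "state h c d a n \<in> borel_measurable (past_sigma M \<xi> (a + int n - 1))"
proof -
  have sub: "sets (past_sigma M \<xi> m) \<subseteq> sets (past_sigma M \<xi> m')" if "m \<le> m'" for m m'
  proof -
    have "{\<xi> k -` B \<inter> space M |k B. k \<le> m \<and> B \<in> sets borel}
      \<subseteq> {\<xi> k -` B \<inter> space M |k B. k \<le> m' \<and> B \<in> sets borel}"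
      using that by (blast intro: order_trans)
    thus ?thesis unfolding past_sigma_def
      by (subst (1 2) sets_measure_of) (auto intro!: sigma_sets_mono')
  qed
  have sp: "space (past_sigma M \<xi> m) = space M" for m
    unfolding past_sigma_def by (rule space_measure_of) auto
  have W: "W m \<in> borel_measurable (past_sigma M \<xi> (a + int n - 1))" if "m \<le> a + int n" for m
    using measurable_mono[OF order_refl refl sub[of "m - 1" "a + int n - 1"]] past_W[of m] sp that by auto
  have \<xi>: "\<xi> m \<in> borel_measurable (past_sigma M \<xi> (a + int n - 1))" if "m < a + int n" for m
  proof (rule measurableI)
    fix A :: "real set" assume "A \<in> sets borel"
    thus "\<xi> m -` A \<inter> space (past_sigma M \<xi> (a + int n - 1)) \<in> sets (past_sigma M \<xi> (a + int n - 1))"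
      unfolding sp unfolding past_sigma_def using that
      by (subst sets_measure_of) (auto intro!: sigma_sets.Basic)
  qed simp
  have "psum h c a n \<in> borel_measurable (past_sigma M \<xi> (a + int n - 1))" for c
    unfolding psum_def
  proof (rule borel_measurable_sum)
    fix k assume "k \<in> {..<n}"
    hence [measurable]: "W (a + int k) \<in> borel_measurable (past_sigma M \<xi> (a + int n - 1))"
      "\<xi> (a + int k) \<in> borel_measurable (past_sigma M \<xi> (a + int n - 1))"
      using W \<xi> by auto
    show "(\<lambda>\<omega>. c k * (h (W (a + int k) \<omega>) * (\<xi> (a + int k) \<omega>)\<^sup>2)) \<in> borel_measurable (past_sigma M \<xi> (a + int n - 1))"
      by measurable
  qed
  thus ?thesis unfolding state_def borel_prod[symmetric] using W by measurable
qed

lemma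
  assumes h: "h \<in> borel_measurable borel"
  shows distr_state_Pair: "distr M borel (\<lambda>\<omega>. (state h c d a n \<omega>, (\<xi> (a + int n) \<omega>)\<^sup>2))
    = distr M borel (state h c d a n) \<Otimes>\<^sub>M distr M borel (\<lambda>\<omega>. (\<xi> (a + int n) \<omega>)\<^sup>2)"
  and rv_state: "random_variable borel (state h c d a n)"
  using distr_Pair_past_sigma[OF indep_\<xi> past_state[OF h, of c d a n], of "a + int n" "\<lambda>x. x\<^sup>2"] by simp_all

text \<open>The initial law is that of \<open>\<sigma>\<close> at a, which does not depend on a.
  Each step is the image, under a map free of a, of the product with the common law of the squared
  innovations.\<close>

lemma distr_state_shift:
  assumes h [measurable]: "h \<in> borel_measurable borel"
  shows "distr M borel (state h c d a n) = distr M borel (state h c d 0 n)"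
proof (induction n)
  case 0
  have "distr M borel (state h c d a 0) = distr (distr M borel (\<sigma> a)) borel (\<lambda>x. (0, 0, \<Lambda> (x\<^sup>2)))" for a
    by (subst distr_distr) (auto simp: state_def[abs_def] psum_def comp_def W_def borel_prod[symmetric])
  thus ?case by (simp add: distr_\<sigma>[of a])
next
  case (Suc n)
  note [measurable] = meas_step[OF h] rv_state[OF h]
  have "distr M borel (\<lambda>\<omega>. (\<xi> m \<omega>)\<^sup>2) = distr (distr M borel (\<xi> m)) borel (\<lambda>x. x\<^sup>2)" for m
    by (subst distr_distr) (auto simp: comp_def)
  hence \<xi>2: "distr M borel (\<lambda>\<omega>. (\<xi> m \<omega>)\<^sup>2) = distr M borel (\<lambda>\<omega>. (\<xi> 0 \<omega>)\<^sup>2)" for m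
    using distr_\<xi>[of m] by simp
  have "distr M borel (state h c d a (Suc n))
    = distr M borel (\<lambda>\<omega>. step h c d n (state h c d a n \<omega>, (\<xi> (a + int n) \<omega>)\<^sup>2))" for a
    by (rule distr_cong) (auto simp: state_Suc)
  also have "\<dots> a = distr (distr M borel (\<lambda>\<omega>. (state h c d a n \<omega>, (\<xi> (a + int n) \<omega>)\<^sup>2))) borel (step h c d n)" for a
    by (subst distr_distr) (auto simp: comp_def intro!: borel_measurable_Pair)
  also have "\<dots> a = distr (distr M borel (state h c d a n) \<Otimes>\<^sub>M distr M borel (\<lambda>\<omega>. (\<xi> 0 \<omega>)\<^sup>2)) borel (step h c d n)" for a
    by (simp only: distr_state_Pair[OF h] \<xi>2[of "a + int n"])
  finally show ?case using Suc.IH by simp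
qed

text \<open>Each state is a monotone image of the previous one paired with an independent real.
  Nonnegative weights and a nonnegative \<open>h\<close> make the products in \<open>step\<close>
  monotone in both factors.\<close>

lemma associated_state:
  assumes h: "mono h" "\<And>w. 0 \<le> h w" and cd: "\<And>k. 0 \<le> c k" "\<And>k. 0 \<le> d k"
  shows "associated (state h c d a n)"
proof (induction n)
  case 0
  show ?case
    by (rule associated_mono[OF associated_real[OF rv_W[of a]], where h="\<lambda>w. (0, 0, w)"])
      (auto simp: state_def psum_def mono_def borel_prod[symmetric])
next
  case (Suc n)
  have hm: "h \<in> borel_measurable borel" by (rule borel_measurable_mono[OF h(1)])
  have step: "mono (step h c d n)"
  proof (rule monoI, clarsimp simp: step_def)
    fix x y w e x' y' w' e' :: real
    assume le: "x \<le> x'" "y \<le> y'" "w \<le> w'" "e \<le> e'"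
    have "h w * max e 0 \<le> h w' * max e' 0"
      using le h by (intro mult_mono) (auto simp: mono_def)
    thus "x + c n * (h w * max e 0) \<le> x' + c n * (h w' * max e' 0) \<and>
       y + d n * (h w * max e 0) \<le> y' + d n * (h w' * max e' 0) \<and> \<phi> (w, max e 0) \<le> \<phi> (w', max e' 0)"
      using le cd by (intro conjI add_mono mult_left_mono mono_\<phi>) auto
  qed
  show ?case
    by (rule associated_mono[OF associated_Pair[OF Suc.IH rv_state[OF hm] _ distr_state_Pair[OF hm]]
          meas_step[OF hm] step])
      (auto simp: state_Suc)
qed

section \<open>Transfer to sums of the squared process\<close>

lemma square_X: "\<omega> \<in> space M \<Longrightarrow> (X n \<omega>)\<^sup>2 = inv_\<Lambda> (W n \<omega>) * (\<xi> n \<omega>)\<^sup>2"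
  by (simp add: X_eq W_def inv_\<Lambda>_\<Lambda> power_mult_distrib)

lemma distr_sum_X_shift:
  assumes "finite A"
  shows "distr M borel (\<lambda>\<omega>. \<Sum>k\<in>A. (X (a + int k) \<omega>)\<^sup>2) = distr M borel (\<lambda>\<omega>. \<Sum>k\<in>A. (X (int k) \<omega>)\<^sup>2)"
proof -
  obtain n where n: "A \<subseteq> {..<n}" using assms finite_nat_iff_bounded by blast
  let ?c = "\<lambda>k. indicator A k :: real"
  have "(\<Sum>k\<in>A. (X (a + int k) \<omega>)\<^sup>2) = fst (state inv_\<Lambda> ?c ?c a n \<omega>)" if "\<omega> \<in> space M" for a \<omega>
    unfolding state_def psum_def using n assms that
    by (simp add: square_X indicator_def if_distrib[of "\<lambda>x. x * _"] sum.If_cases Int_absorb1 cong: if_cong)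
  hence "distr M borel (\<lambda>\<omega>. \<Sum>k\<in>A. (X (a + int k) \<omega>)\<^sup>2) = distr M borel (\<lambda>\<omega>. fst (state inv_\<Lambda> ?c ?c a n \<omega>))" for a
    by (intro distr_cong) auto
  also have "\<dots> a = distr (distr M borel (state inv_\<Lambda> ?c ?c a n)) borel fst" for a
    using rv_state by (subst distr_distr) (auto simp: comp_def borel_prod[symmetric])
  finally have *: "distr M borel (\<lambda>\<omega>. \<Sum>k\<in>A. (X (a + int k) \<omega>)\<^sup>2) = distr (distr M borel (state inv_\<Lambda> ?c ?c a n)) borel fst" for a .
  show ?thesis using *[of a] *[of 0] distr_state_shift[OF meas_inv_\<Lambda>, of ?c ?c a n] by simp
qed

text \<open>The test functions are merely monotone and may jump, so convergence of the truncated
  sums would not suffice. At each sample point the truncation is inactive for large K, because the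
  sums are finite; the test functions are then eventually constant in K.\<close>

lemma pqd_sum_X:
  assumes "finite A" "finite B"
  shows "pqd (\<lambda>\<omega>. \<Sum>k\<in>A. (X (a + int k) \<omega>)\<^sup>2) (\<lambda>\<omega>. \<Sum>k\<in>B. (X (a + int k) \<omega>)\<^sup>2)"
  unfolding pqd_def
proof safe
  fix f g :: "real \<Rightarrow> real"
  assume m: "mono f" "mono g" and b: "bounded (range f)" "bounded (range g)"
  note [measurable] = borel_measurable_mono[OF m(1)] borel_measurable_mono[OF m(2)]
  obtain Cf Cg where C: "\<And>x. \<bar>f x\<bar> \<le> Cf" "\<And>x. \<bar>g x\<bar> \<le> Cg" using b unfolding bounded_iff by auto
  obtain n where n: "A \<union> B \<subseteq> {..<n}" using assms finite_nat_iff_bounded[of "A \<union> B"] by blast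
  define U where "U D K \<omega> = (\<Sum>k\<in>D. min ((\<sigma> (a + int k) \<omega>)\<^sup>2) (real K) * (\<xi> (a + int k) \<omega>)\<^sup>2)" for D K \<omega>
  define S where "S D \<omega> = (\<Sum>k\<in>D. (X (a + int k) \<omega>)\<^sup>2)" for D \<omega>
  have [measurable]: "random_variable borel (U D K)" "random_variable borel (S D)" for D K
    unfolding U_def S_def by measurable
  have lim: "\<forall>\<^sub>F K in sequentially. U D K \<omega> = S D \<omega>" if "finite D" "\<omega> \<in> space M" for D \<omega>
  proof -
    have "\<forall>\<^sub>F K in sequentially. \<forall>k\<in>D. min ((\<sigma> (a + int k) \<omega>)\<^sup>2) (real K) = (\<sigma> (a + int k) \<omega>)\<^sup>2"
      using that(1) by (intro eventually_ball_finite ballI eventually_min_eq)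
    thus ?thesis
    proof eventually_elim
      case (elim K)
      thus ?case using that(2) unfolding U_def S_def by (intro sum.cong) (auto simp: X_eq power_mult_distrib)
    qed
  qed
  have limh: "(\<lambda>K. h (U D K \<omega>)) \<longlonglongrightarrow> h (S D \<omega>)" if "finite D" "\<omega> \<in> space M" for D \<omega> and h :: "real \<Rightarrow> real"
    by (rule tendsto_eventually) (use lim[OF that] in \<open>auto elim: eventually_mono\<close>)
  have ineq: "expectation (\<lambda>\<omega>. f (U A K \<omega>)) * expectation (\<lambda>\<omega>. g (U B K \<omega>)) \<le> expectation (\<lambda>\<omega>. f (U A K \<omega>) * g (U B K \<omega>))" for K
  proof -
    let ?s = "state (inv_trunc K) (indicator A) (indicator B) a n"
    have as: "associated ?s"
      by (rule associated_state) (auto intro: mono_inv_trunc inv_trunc_nonneg)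
    \<comment> \<open>W is \<open>\<Lambda>\<close> of the squared volatility, where
      \<open>inv_trunc K\<close> is exactly the minimum with K.\<close>
    have Us: "U A K \<omega> = fst (?s \<omega>)" "U B K \<omega> = fst (snd (?s \<omega>))" for \<omega>
      unfolding U_def state_def psum_def W_def using n assms
      by (simp_all add: inv_trunc_\<Lambda> indicator_def if_distrib[of "\<lambda>x. x * _"] sum.If_cases Int_absorb1 cong: if_cong)
    have "mono (\<lambda>p :: real \<times> real \<times> real. f (fst p))" "mono (\<lambda>p :: real \<times> real \<times> real. g (fst (snd p)))"
      using m by (auto simp: mono_def)
    moreover have "bounded (range (\<lambda>p :: real \<times> real \<times> real. f (fst p)))" "bounded (range (\<lambda>p :: real \<times> real \<times> real. g (fst (snd p))))"
      using C by (auto simp: bounded_iff)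
    moreover have "(\<lambda>p :: real \<times> real \<times> real. f (fst p)) \<in> borel_measurable borel"
      "(\<lambda>p :: real \<times> real \<times> real. g (fst (snd p))) \<in> borel_measurable borel"
      by (auto simp: borel_prod[symmetric])
    ultimately show ?thesis using as unfolding associated_def Us by blast
  qed
  have C0: "0 \<le> Cf" "0 \<le> Cg" using C(1)[of 0] C(2)[of 0] by linarith+
  have 1: "(\<lambda>K. expectation (\<lambda>\<omega>. f (U A K \<omega>))) \<longlonglongrightarrow> expectation (\<lambda>\<omega>. f (S A \<omega>))"
    by (rule integral_dominated_convergence[where w="\<lambda>_. Cf"]) (use C limh assms in \<open>auto intro!: AE_I2\<close>)
  have 2: "(\<lambda>K. expectation (\<lambda>\<omega>. g (U B K \<omega>))) \<longlonglongrightarrow> expectation (\<lambda>\<omega>. g (S B \<omega>))"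
    by (rule integral_dominated_convergence[where w="\<lambda>_. Cg"]) (use C limh assms in \<open>auto intro!: AE_I2\<close>)
  have 3: "(\<lambda>K. expectation (\<lambda>\<omega>. f (U A K \<omega>) * g (U B K \<omega>))) \<longlonglongrightarrow> expectation (\<lambda>\<omega>. f (S A \<omega>) * g (S B \<omega>))"
    by (rule integral_dominated_convergence[where w="\<lambda>_. Cf * Cg"])
      (use C C0 limh assms in \<open>auto intro!: AE_I2 tendsto_mult mult_mono simp: abs_mult\<close>)
  show "expectation (\<lambda>\<omega>. f (\<Sum>k\<in>A. (X (a + int k) \<omega>)\<^sup>2)) * expectation (\<lambda>\<omega>. g (\<Sum>k\<in>B. (X (a + int k) \<omega>)\<^sup>2))
    \<le> expectation (\<lambda>\<omega>. f (\<Sum>k\<in>A. (X (a + int k) \<omega>)\<^sup>2) * g (\<Sum>k\<in>B. (X (a + int k) \<omega>)\<^sup>2))"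
    using LIMSEQ_le[OF tendsto_mult[OF 1 2] 3] ineq unfolding S_def by blast
qed

lemma distr_square_X: "distr M borel (\<lambda>\<omega>. (X k \<omega>)\<^sup>2) = distr M borel (\<lambda>\<omega>. (X 0 \<omega>)\<^sup>2)"
  using distr_sum_X_shift[of "{0}" k] by simp

lemma lpqd_process_square_X:
  assumes X4: "integrable M (\<lambda>\<omega>. (X 0 \<omega>) ^ 4)"
    and cov: "summable (\<lambda>k::nat. covar (\<lambda>\<omega>. (X 1 \<omega>)\<^sup>2) (\<lambda>\<omega>. (X (int k + 1) \<omega>)\<^sup>2))"
  shows "lpqd_process M (\<lambda>k \<omega>. (X (int k + 1) \<omega>)\<^sup>2 - expectation (\<lambda>\<omega>. (X 0 \<omega>)\<^sup>2))"
proof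
  define \<mu> where "\<mu> = expectation (\<lambda>\<omega>. (X 0 \<omega>)\<^sup>2)"
  have X22: "integrable M (\<lambda>\<omega>. ((X k \<omega>)\<^sup>2)\<^sup>2)" for k
  proof -
    have "integrable (distr M borel (\<lambda>\<omega>. (X 0 \<omega>)\<^sup>2)) (\<lambda>x. x\<^sup>2)"
      using X4 by (subst integrable_distr_eq) auto
    thus ?thesis unfolding distr_square_X[symmetric, of k] by (subst (asm) integrable_distr_eq) auto
  qed
  have X2 [simp]: "integrable M (\<lambda>\<omega>. (X k \<omega>)\<^sup>2)" for k
    by (rule square_integrable_imp_integrable[OF _ X22]) measurable
  have \<mu>: "expectation (\<lambda>\<omega>. (X k \<omega>)\<^sup>2) = \<mu>" for k
    using arg_cong[OF distr_square_X[of k], of "\<lambda>N. (LINT x|N. x)"] by (simp add: integral_distr \<mu>_def)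
  let ?Y = "\<lambda>k \<omega>. (X (int k + 1) \<omega>)\<^sup>2 - \<mu>"
  show "random_variable borel (?Y k)" for k by measurable
  show "integrable M (\<lambda>\<omega>. (?Y k \<omega>)\<^sup>2)" for k
    using integrable_square_add[OF _ _ X22[of "int k + 1"], of "\<lambda>_. - \<mu>"] by simp
  show "expectation (?Y k) = 0" for k by (simp add: \<mu> prob_space)
  have sum_Y: "(\<Sum>k\<in>A. ?Y (k + h) \<omega>) = (\<Sum>k\<in>A. (X ((int h + 1) + int k) \<omega>)\<^sup>2) - real (card A) * \<mu>" for A h \<omega>
    by (simp add: sum_subtractf add_ac)
  have sum_Y0: "(\<Sum>k\<in>A. ?Y k \<omega>) = (\<Sum>k\<in>A. (X (1 + int k) \<omega>)\<^sup>2) - real (card A) * \<mu>" for A \<omega>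
    by (simp add: sum_subtractf add.commute)
  show "distr M borel (\<lambda>\<omega>. \<Sum>k\<in>A. ?Y (k + h) \<omega>) = distr M borel (\<lambda>\<omega>. \<Sum>k\<in>A. ?Y k \<omega>)"
    if A: "finite A" for A h
  proof -
    have "distr M borel (\<lambda>\<omega>. \<Sum>k\<in>A. ?Y (k + h) \<omega>)
      = distr (distr M borel (\<lambda>\<omega>. \<Sum>k\<in>A. (X ((int h + 1) + int k) \<omega>)\<^sup>2)) borel (\<lambda>x. x - real (card A) * \<mu>)" for h
      unfolding sum_Y by (subst distr_distr) (auto simp: comp_def)
    \<comment> \<open>Instance 0 describes the unshifted sum, which itself starts at index 1; both
      laws are compared with that of the sum starting at index 0.\<close>
    from this[of h] this[of 0] show ?thesis
      by (simp only: distr_sum_X_shift[OF A] add_0_right)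
  qed
  show "pqd (\<lambda>\<omega>. \<Sum>k\<in>A. ?Y k \<omega>) (\<lambda>\<omega>. \<Sum>k\<in>B. ?Y k \<omega>)" if "finite A" "finite B" for A B
    unfolding pqd_def
  proof safe
    fix f g :: "real \<Rightarrow> real"
    assume m: "mono f" "mono g" and b: "bounded (range f)" "bounded (range g)"
    \<comment> \<open>Centring shifts the sums by constants, which are absorbed into the monotone
      test functions.\<close>
    let ?f = "\<lambda>x. f (x - real (card A) * \<mu>)" and ?g = "\<lambda>x. g (x - real (card B) * \<mu>)"
    have "mono ?f" "mono ?g" using m by (auto simp: mono_def)
    moreover have "bounded (range ?f)" "bounded (range ?g)" using b by (auto intro: bounded_subset)
    ultimately show "expectation (\<lambda>\<omega>. f (\<Sum>k\<in>A. ?Y k \<omega>)) * expectation (\<lambda>\<omega>. g (\<Sum>k\<in>B. ?Y k \<omega>))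
      \<le> expectation (\<lambda>\<omega>. f (\<Sum>k\<in>A. ?Y k \<omega>) * g (\<Sum>k\<in>B. ?Y k \<omega>))"
      using pqd_sum_X[OF that, of 1] unfolding pqd_def sum_Y0 by blast
  qed
  show "summable (\<lambda>k. expectation (\<lambda>\<omega>. ?Y 0 \<omega> * ?Y k \<omega>))"
    using cov by (simp add: covar_def \<mu>)
qed

end

theorem theorem2p4:
  fixes M :: "'a measure"
    and X \<xi> \<sigma> :: "int \<Rightarrow> 'a \<Rightarrow> real"
    and \<phi> :: "real \<times> real \<Rightarrow> real"
    and \<Lambda> :: "real \<Rightarrow> real"
    and T :: "nat \<Rightarrow> 'a \<Rightarrow> real"
  assumes "prob_space M"
    and "prob_space.aug_garch M X \<xi> \<sigma> \<phi> \<Lambda>"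
    and "integrable M (\<lambda>\<omega>. (X 0 \<omega>) ^ 4)"
    and "summable (\<lambda>k::nat. prob_space.covar M (\<lambda>\<omega>. (X 1 \<omega>)\<^sup>2)
                                             (\<lambda>\<omega>. (X (int k + 1) \<omega>)\<^sup>2))"
    and "\<And>n \<omega>. T n \<omega> = (1 / sqrt (real n)) *
            (\<Sum>k=1..n. ((X (int k) \<omega>)\<^sup>2 - prob_space.expectation M (\<lambda>\<omega>'. (X 0 \<omega>')\<^sup>2)))"
  shows "\<forall>t::real. AE \<omega> in M.
           (\<lambda>n. \<bar>measure M {\<omega>'\<in>space M. T n \<omega>' \<le> t}
                 - (1 / ln (real n)) * (\<Sum>k=1..n. (1 / real k) * indicator {\<omega>'. T k \<omega>' \<le> t} \<omega>)\<bar>)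
           \<longlonglongrightarrow> 0"
proof -
  interpret prob_space M by fact
  interpret garch M X \<xi> \<sigma> \<phi> \<Lambda> by unfold_locales fact
  interpret Y: lpqd_process M "\<lambda>k \<omega>. (X (int k + 1) \<omega>)\<^sup>2 - expectation (\<lambda>\<omega>. (X 0 \<omega>)\<^sup>2)"
    by (rule lpqd_process_square_X) fact+
  \<comment> \<open>The abstract process starts at index 0 with the square of X at 1, so the sum
    over 1..n is reindexed by \<open>Suc\<close>.\<close>
  have "T n \<omega> = Y.T n \<omega>" for n \<omega>
  proof -
    have "(\<Sum>k=1..n. ((X (int k) \<omega>)\<^sup>2 - expectation (\<lambda>\<omega>'. (X 0 \<omega>')\<^sup>2))) = Y.S n \<omega>"
      unfolding Y.S_def
      by (rule sum.reindex_bij_witness[of _ Suc "\<lambda>k. k - 1"]) (auto simp: add_ac of_nat_diff)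
    thus ?thesis by (simp add: assms(5) Y.T_def)
  qed
  hence "T = Y.T" by (intro ext)
  thus ?thesis using Y.AE_log_mean_T unfolding log_mean_def by simp
qed

end
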